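(* Let $\{S_i\}_{i=1}^{N}$ be an iterated function system of contracting similarity transformations of $\mathbb{R}^2$ which satisfies the convex open set condition, and let $F$ be its attractor. Assume that $F$ is not a subset of a straight line. Suppose that $\mathrm{proj}_\theta F$ is an interval for all directions $\theta$. Then $$\dim_H V_\theta F = \dim_B V_\theta F = 1$$ for all directions $\theta$.
   Context: A direction is a unit vector $\theta\in\mathbb{R}^2$. Put $l_\theta=\{r\theta : r\ge 0\}$ (the half-line from the origin in direction $\theta$), $\Pi_\theta=\{x : x\cdot\theta=0\}$ (the linear subspace perpendicular to $\theta$), and let $\mathrm{proj}_\theta:\mathbb{R}^2\to\Pi_\theta$ be orthogonal projection onto $\Pi_\theta$; "interval" means an interval in the line $\Pi_\theta$. For compact $F\subset\mathbb{R}^2$, the visible part of $F$ from direction $\theta$ is $V_\theta F=\{x\in F : (x+l_\theta)\cap F=\{x\}\}$. The attractor of $\{S_i\}_{i=1}^N$ is the unique non-empty compact set $F$ with $F=\bigcup_{i=1}^N S_i(F)$. The system satisfies the convex open set condition if there is a non-empty convex open set $O\subseteq\mathbb{R}^2$ with $\bigcup_{i=1}^N S_i(O)\subseteq O$ and the sets $S_i(O)$ pairwise disjoint. $\dim_H$ denotes Hausdorff dimension and $\dim_B$ box-counting dimension (the assertion $\dim_B V_\theta F=1$ means that the lower and upper box-counting dimensions both equal 1). *)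

theory Defs
  imports "HOL-Analysis.Analysis"
begin

section \<open>Hausdorff dimension\<close>

text \<open>The term contributed by a covering set \<open>U\<close>, i.e. \<open>diam(U)\<^sup>s\<close> with the usual conventions
  at \<open>s = 0\<close>: nonempty sets count 1 and the empty set counts 0 (whereas \<open>0 powr 0 = 0\<close>).\<close>

definition diam_pow :: "real \<Rightarrow> 'a::metric_space set \<Rightarrow> ennreal" where
  "diam_pow s U =
     (if U = {} then 0 else if s = 0 then 1 else ennreal (diameter U powr s))"

text \<open>Covering sets are required to be bounded here and below because \<^const>\<open>diameter\<close> is
  real-valued and carries no information about unbounded sets.\<close>

definition hausdorff_premeasure :: "real \<Rightarrow> real \<Rightarrow> 'a::metric_space set \<Rightarrow> ennreal" where
  "hausdorff_premeasure s \<delta> A =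
     Inf {(\<Sum>i. diam_pow s (U i)) | U :: nat \<Rightarrow> 'a set.
            A \<subseteq> (\<Union>i. U i) \<and> (\<forall>i. bounded (U i) \<and> diameter (U i) \<le> \<delta>)}"

definition hausdorff_measure :: "real \<Rightarrow> 'a::metric_space set \<Rightarrow> ennreal" where
  "hausdorff_measure s A = (SUP \<delta>\<in>{0<..}. hausdorff_premeasure s \<delta> A)"

definition hausdorff_dim :: "'a::metric_space set \<Rightarrow> ereal" where
  "hausdorff_dim A = Inf (ereal ` {s. 0 \<le> s \<and> hausdorff_measure s A = 0})"


section \<open>Box-counting dimension\<close>

text \<open>The least number of sets of diameter at most \<open>\<delta>\<close> that cover \<open>A\<close>; meaningful only when a
  finite such cover exists, in particular for bounded subsets of Euclidean space.\<close>

definition covering_number :: "real \<Rightarrow> 'a::metric_space set \<Rightarrow> nat" where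
  "covering_number \<delta> A =
     (LEAST n. \<exists>\<U>. finite \<U> \<and> card \<U> = n \<and> A \<subseteq> \<Union>\<U> \<and>
                   (\<forall>U\<in>\<U>. bounded U \<and> diameter U \<le> \<delta>))"

definition lower_box_dim :: "'a::metric_space set \<Rightarrow> ereal" where
  "lower_box_dim A =
     Liminf (at_right 0) (\<lambda>\<delta>. ereal (ln (real (covering_number \<delta> A)) / - ln \<delta>))"

definition upper_box_dim :: "'a::metric_space set \<Rightarrow> ereal" where
  "upper_box_dim A =
     Limsup (at_right 0) (\<lambda>\<delta>. ereal (ln (real (covering_number \<delta> A)) / - ln \<delta>))"


section \<open>Self-similar sets\<close>

definition contracting_similarity :: "('a::metric_space \<Rightarrow> 'a) \<Rightarrow> bool" where
  "contracting_similarity f \<longleftrightarrow>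
     (\<exists>r. 0 < r \<and> r < 1 \<and> (\<forall>x y. dist (f x) (f y) = r * dist x y))"

text \<open>A system \<open>S\<^sub>1, \<dots>, S\<^sub>N\<close> is given by a function on \<^typ>\<open>nat\<close> of which only the values
  at \<open>1, \<dots>, N\<close> are used.\<close>

definition convex_open_set_condition ::
    "nat \<Rightarrow> (nat \<Rightarrow> 'a::real_normed_vector \<Rightarrow> 'a) \<Rightarrow> bool" where
  "convex_open_set_condition N S \<longleftrightarrow>
     (\<exists>U. U \<noteq> {} \<and> convex U \<and> open U \<and>
          (\<Union>i\<in>{1..N}. S i ` U) \<subseteq> U \<and> disjoint_family_on (\<lambda>i. S i ` U) {1..N})"

text \<open>For contractions of a complete space and \<open>N \<ge> 1\<close> there is exactly one such set
  (Hutchinson).\<close>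

definition is_attractor :: "nat \<Rightarrow> (nat \<Rightarrow> 'a::metric_space \<Rightarrow> 'a) \<Rightarrow> 'a set \<Rightarrow> bool" where
  "is_attractor N S F \<longleftrightarrow> F \<noteq> {} \<and> compact F \<and> F = (\<Union>i\<in>{1..N}. S i ` F)"


section \<open>Projections and visible parts\<close>

definition half_line :: "real^2 \<Rightarrow> (real^2) set" where
  "half_line \<theta> = {r *\<^sub>R \<theta> | r. 0 \<le> r}"

definition perp_line :: "real^2 \<Rightarrow> (real^2) set" where
  "perp_line \<theta> = {x. x \<bullet> \<theta> = 0}"

definition proj :: "real^2 \<Rightarrow> real^2 \<Rightarrow> real^2" where
  "proj \<theta> x = x - (x \<bullet> \<theta>) *\<^sub>R \<theta>"

lemma proj_eq_closest_point:
  assumes "norm \<theta> = 1"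
  shows "proj \<theta> x = closest_point (perp_line \<theta>) x"
proof (rule closest_point_unique)
  have perp: "perp_line \<theta> = {y. \<theta> \<bullet> y = 0}"
    by (auto simp: perp_line_def inner_commute)
  show "convex (perp_line \<theta>)" "closed (perp_line \<theta>)"
    unfolding perp by (rule convex_hyperplane closed_hyperplane)+
  have unit: "\<theta> \<bullet> \<theta> = 1"
    using assms by (simp add: norm_eq_1)
  show "proj \<theta> x \<in> perp_line \<theta>"
    by (simp add: perp_line_def proj_def inner_diff_left unit)
  show "\<forall>z\<in>perp_line \<theta>. dist x (proj \<theta> x) \<le> dist x z"
  proof
    fix z assume "z \<in> perp_line \<theta>"
    then have "x \<bullet> \<theta> = (x - z) \<bullet> \<theta>"
      by (simp add: perp_line_def inner_diff_left)
    then have "\<bar>x \<bullet> \<theta>\<bar> \<le> norm (x - z)"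
      using Cauchy_Schwarz_ineq2[of "x - z" \<theta>] assms by simp
    then show "dist x (proj \<theta> x) \<le> dist x z"
      by (simp add: proj_def dist_norm assms)
  qed
qed

text \<open>An interval in a line \<open>L\<close>: the image of a real interval under an affine parametrization
  of \<open>L\<close>.  (\<^const>\<open>is_interval\<close> on \<^typ>\<open>real^2\<close> itself would describe axis-parallel boxes.)\<close>

definition interval_in_line :: "'a::real_vector set \<Rightarrow> 'a set \<Rightarrow> bool" where
  "interval_in_line L J \<longleftrightarrow>
     (\<exists>a v T. v \<noteq> 0 \<and> L = range (\<lambda>t::real. a + t *\<^sub>R v) \<and>
              is_interval T \<and> J = (\<lambda>t. a + t *\<^sub>R v) ` T)"

definition visible_part :: "real^2 \<Rightarrow> (real^2) set \<Rightarrow> (real^2) set" where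
  "visible_part \<theta> F = {x \<in> F. (\<lambda>y. x + y) ` half_line \<theta> \<inter> F = {x}}"

end

theory Submission
  imports Defs
begin

text \<open>
  The lower bounds are immediate: the visible part has the same projection along \<open>\<theta>\<close> as \<open>F\<close>, an
  interval of positive length, and projections do not increase distances.

  For the upper bounds, \<open>F\<close> is tiled at each scale \<open>\<delta>\<close> by similar copies of itself whose convex
  hulls have disjoint interiors (\<open>tilings_at_all_scales\<close>), and the copies that contain a visible
  point are counted. Let there be \<open>N(\<delta>)\<close> of them. Every copy projects onto an interval along \<open>\<theta>\<close>, since
  \<open>F\<close> projects onto an interval in every direction. So a copy whose projection extends across a
  strip parallel to \<open>\<theta>\<close> blocks the view in the whole strip, up to points where hulls touch: at most two
  copies that cross the strip can be visible in it (\<open>card_crossing_le_2\<close>). Any other visible copy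
  that meets the strip ends in it, and a copy ends in only two strips. With strips of width
  \<open>\<rho> \<delta>\<close> the number of pairs of a strip and a copy visible in it is therefore at most
  \<open>O(1 / (\<rho> \<delta>)) + 2 N(\<delta>)\<close>. For each pair, a packing argument leaves room for at most \<open>O(1 / \<rho>)\<close> copies
  of the scale \<open>\<rho> \<delta>\<close> in the intersection of the copy and the strip. Hence
  \<open>N(\<rho> \<delta>) \<le> (C / \<rho>) (1 / (\<rho> \<delta>) + N(\<delta>))\<close> with \<open>C\<close> independent of \<open>\<rho>\<close> and \<open>\<delta>\<close>
  (\<open>card_visible_pieces_step\<close>), and iteration gives \<open>N(\<rho>\<^sup>m) \<le> (1 / \<rho>) (2 C / \<rho>)\<^sup>m\<close>. This bounds the dimensions
  by \<open>1 + ln (2 C) / ln (1 / \<rho>)\<close>, and the excess over 1 disappears as \<open>\<rho>\<close> tends to 0.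
\<close>

section \<open>Dimension bounds from coverings and projections\<close>

lemma covering_number_le:
  assumes "finite \<U>" "A \<subseteq> \<Union>\<U>" "\<And>U. U \<in> \<U> \<Longrightarrow> bounded U \<and> diameter U \<le> \<delta>"
  shows "covering_number \<delta> A \<le> card \<U>"
  unfolding covering_number_def by (rule Least_le) (use assms in blast)

lemma covering_number_attained:
  assumes "finite \<U>" "A \<subseteq> \<Union>\<U>" "\<And>U. U \<in> \<U> \<Longrightarrow> bounded U \<and> diameter U \<le> \<delta>"
  obtains \<V> where "finite \<V>" "card \<V> = covering_number \<delta> A" "A \<subseteq> \<Union>\<V>"
    "\<And>V. V \<in> \<V> \<Longrightarrow> bounded V \<and> diameter V \<le> \<delta>"
proof -
  let ?P = "\<lambda>n. \<exists>\<U>. finite \<U> \<and> card \<U> = n \<and> A \<subseteq> \<Union>\<U> \<and>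
                   (\<forall>U\<in>\<U>. bounded U \<and> diameter U \<le> \<delta>)"
  have "?P (card \<U>)" using assms by blast
  then have "?P (covering_number \<delta> A)"
    unfolding covering_number_def by (rule LeastI)
  then show ?thesis using that by blast
qed

text \<open>A covering of a set is carried by the contraction \<open>x \<mapsto> x \<bullet> e\<close> to a covering of its shadow by
  intervals that are no longer than the diameters of the covering sets. Countable subadditivity of
  Lebesgue measure then bounds the length of any interval in the shadow. This is the only source of
  lower bounds below.\<close>

lemma interval_le_suminf_diameter:
  fixes U :: "nat \<Rightarrow> 'a::euclidean_space set"
  assumes e: "norm e = 1" and ab: "a \<le> b"
    and cover: "{a..b} \<subseteq> (\<lambda>x. x \<bullet> e) ` (\<Union>i. U i)"
    and bdd: "\<And>i. bounded (U i)"
  shows "ennreal (b - a) \<le> (\<Sum>i. ennreal (diameter (U i)))"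
proof -
  define c where "c i = Inf ((\<lambda>x. x \<bullet> e) ` U i)" for i
  define I where "I i = (if U i = {} then {} else {c i..c i + diameter (U i)})" for i
  have sub: "(\<lambda>x. x \<bullet> e) ` U i \<subseteq> I i" for i
  proof
    fix t assume "t \<in> (\<lambda>x. x \<bullet> e) ` U i"
    then obtain x where x: "x \<in> U i" "t = x \<bullet> e" by auto
    have diff: "\<bar>y \<bullet> e - z \<bullet> e\<bar> \<le> diameter (U i)" if "y \<in> U i" "z \<in> U i" for y z
    proof -
      have "\<bar>y \<bullet> e - z \<bullet> e\<bar> = \<bar>(y - z) \<bullet> e\<bar>" by (simp add: inner_diff_left)
      also have "\<dots> \<le> norm (y - z)" using Cauchy_Schwarz_ineq2[of "y - z" e] e by simp
      also have "\<dots> \<le> diameter (U i)"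
        using diameter_bounded_bound[OF bdd that] by (simp add: dist_norm)
      finally show ?thesis .
    qed
    have low: "x \<bullet> e - diameter (U i) \<le> y \<bullet> e" if "y \<in> U i" for y
      using diff[OF x(1) that] by linarith
    have "c i \<le> x \<bullet> e" unfolding c_def
      by (rule cInf_lower) (use x low in \<open>auto intro!: bdd_belowI[where m="x \<bullet> e - diameter (U i)"]\<close>)
    moreover have "x \<bullet> e - diameter (U i) \<le> c i" unfolding c_def
      by (rule cInf_greatest) (use x low in auto)
    ultimately show "t \<in> I i" using x by (auto simp: I_def)
  qed
  have "ennreal (b - a) = emeasure lborel {a..b}" using ab by simp
  also have "\<dots> \<le> emeasure lborel (\<Union>i. I i)"
  proof (rule emeasure_mono)
    have "{a..b} \<subseteq> (\<Union>i. (\<lambda>x. x \<bullet> e) ` U i)" using cover by (simp add: image_UN)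
    also have "\<dots> \<subseteq> (\<Union>i. I i)" by (rule UN_mono) (use sub in auto)
    finally show "{a..b} \<subseteq> (\<Union>i. I i)" .
  qed (auto simp: I_def)
  also have "\<dots> \<le> (\<Sum>i. emeasure lborel (I i))"
    by (rule emeasure_subadditive_countably) (auto simp: I_def)
  also have "\<dots> \<le> (\<Sum>i. ennreal (diameter (U i)))"
    by (rule suminf_le) (auto simp: I_def bdd diameter_ge_0)
  finally show ?thesis .
qed

lemma finite_family_as_sequence:
  assumes fin: "finite \<U>"
  obtains V :: "nat \<Rightarrow> 'a set" where "\<And>i. i < card \<U> \<Longrightarrow> V i \<in> \<U>"
    "\<And>i. \<not> i < card \<U> \<Longrightarrow> V i = {}" "(\<Union>i. V i) = \<Union>\<U>"
proof -
  obtain f where f: "f ` {0..<card \<U>} = \<U>"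
    using ex_bij_betw_nat_finite[OF fin] by (auto simp: bij_betw_def)
  define V where "V i = (if i < card \<U> then f i else {})" for i
  have "V i \<in> \<U>" if "i < card \<U>" for i
    using imageI[of i "{0..<card \<U>}" f] f that by (simp add: V_def)
  moreover have "(\<Union>i. V i) = \<Union> (f ` {0..<card \<U>})"
    by (auto simp: V_def split: if_splits)
  ultimately show ?thesis using that[of V] f by (auto simp: V_def)
qed

lemma interval_le_card_mult:
  fixes \<U> :: "'a::euclidean_space set set"
  assumes e: "norm e = 1" and ab: "a \<le> b" and fin: "finite \<U>"
    and cover: "{a..b} \<subseteq> (\<lambda>x. x \<bullet> e) ` \<Union>\<U>"
    and U: "\<And>U. U \<in> \<U> \<Longrightarrow> bounded U \<and> diameter U \<le> \<delta>"
  shows "b - a \<le> real (card \<U>) * \<delta>"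
proof -
  obtain V where V: "\<And>i. i < card \<U> \<Longrightarrow> V i \<in> \<U>"
    and empty: "\<And>i. \<not> i < card \<U> \<Longrightarrow> V i = {}" and union: "(\<Union>i. V i) = \<Union>\<U>"
    using finite_family_as_sequence[OF fin] by blast
  have bdd: "bounded (V i)" for i
    using V U empty by (cases "i < card \<U>") auto
  have zero: "diameter (V i) = 0" if "i \<notin> {..<card \<U>}" for i
    using that by (simp add: empty)
  have "ennreal (b - a) \<le> (\<Sum>i. ennreal (diameter (V i)))"
    by (rule interval_le_suminf_diameter[OF e ab]) (use cover union bdd in auto)
  also have "\<dots> = (\<Sum>i<card \<U>. ennreal (diameter (V i)))"
    by (rule suminf_finite) (auto simp: zero)
  also have "\<dots> = ennreal (\<Sum>i<card \<U>. diameter (V i))"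
    by (rule sum_ennreal) (simp add: bdd diameter_ge_0)
  finally have "b - a \<le> (\<Sum>i<card \<U>. diameter (V i))"
    by (subst (asm) ennreal_le_iff) (auto intro!: sum_nonneg simp: bdd diameter_ge_0)
  also have "\<dots> \<le> (\<Sum>i<card \<U>. \<delta>)" by (rule sum_mono) (use V U in auto)
  finally show ?thesis by simp
qed

text \<open>For \<open>s \<le> 1\<close> and sets of diameter at most 1, \<open>diam\<^sup>s\<close> dominates \<open>diam\<close>, so that the
  premeasure at scale 1 is at least the length of the interval.\<close>

lemma one_le_hausdorff_dim:
  fixes A :: "'a::euclidean_space set"
  assumes e: "norm e = 1" and ab: "a < b" and sub: "{a..b} \<subseteq> (\<lambda>x. x \<bullet> e) ` A"
  shows "1 \<le> hausdorff_dim A"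
  unfolding hausdorff_dim_def
proof (rule Inf_greatest)
  fix z assume "z \<in> ereal ` {s. 0 \<le> s \<and> hausdorff_measure s A = 0}"
  then obtain s where s: "z = ereal s" "0 \<le> s" "hausdorff_measure s A = 0" by auto
  have "1 \<le> s"
  proof (rule ccontr)
    assume "\<not> 1 \<le> s"
    then have s1: "s < 1" by simp
    have "hausdorff_premeasure s 1 A \<le> hausdorff_measure s A"
      unfolding hausdorff_measure_def by (rule SUP_upper) simp
    moreover have "ennreal (b - a) \<le> hausdorff_premeasure s 1 A"
      unfolding hausdorff_premeasure_def
    proof (rule Inf_greatest, clarify)
      fix U :: "nat \<Rightarrow> 'a set"
      assume cov: "A \<subseteq> (\<Union>i. U i)" and U: "\<forall>i. bounded (U i) \<and> diameter (U i) \<le> 1"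
      have "ennreal (b - a) \<le> (\<Sum>i. ennreal (diameter (U i)))"
        by (rule interval_le_suminf_diameter[OF e]) (use ab cov sub U in \<open>force+\<close>)
      also have "\<dots> \<le> (\<Sum>i. diam_pow s (U i))"
      proof (rule suminf_le)
        fix i
        have d: "0 \<le> diameter (U i)" "diameter (U i) \<le> 1"
          using U by (auto simp: diameter_ge_0)
        have "diameter (U i) \<le> diameter (U i) powr s"
        proof (cases "diameter (U i) = 0")
          case False
          then show ?thesis using powr_mono'[of s 1 "diameter (U i)"] d s1 by simp
        qed simp
        then show "ennreal (diameter (U i)) \<le> diam_pow s (U i)"
          using d by (auto simp: diam_pow_def intro!: ennreal_leI)
      qed auto
      finally show "ennreal (b - a) \<le> (\<Sum>i. diam_pow s (U i))" .
    qed
    ultimately have "ennreal (b - a) = 0" using s(3) by simp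
    with ab show False by (simp add: ennreal_eq_0_iff)
  qed
  then show "1 \<le> z" by (simp add: s)
qed

text \<open>A power bound on covering numbers that holds uniformly down to scale 0. Stated by means of
  explicit coverings, it controls the Hausdorff dimension and the upper box dimension alike.\<close>

definition covered_at_rate :: "real \<Rightarrow> 'a::metric_space set \<Rightarrow> bool" where
  "covered_at_rate s A \<longleftrightarrow>
     (\<exists>K>0. \<forall>\<delta>. 0 < \<delta> \<longrightarrow> \<delta> \<le> 1 \<longrightarrow>
        (\<exists>\<U>. finite \<U> \<and> A \<subseteq> \<Union>\<U> \<and> (\<forall>U\<in>\<U>. bounded U \<and> diameter U \<le> \<delta>) \<and>
             real (card \<U>) \<le> K * \<delta> powr - s))"

text \<open>The covering at scale \<open>\<delta>\<close> costs at most \<open>K \<delta>\<^sup>-\<^sup>s \<delta>\<^sup>t\<close>, which tends to 0 with \<open>\<delta>\<close>.\<close>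

lemma hausdorff_measure_eq_0:
  fixes A :: "'a::metric_space set"
  assumes "covered_at_rate s A" and st: "s < t" "0 < t"
  shows "hausdorff_measure t A = 0"
proof -
  obtain K where K: "K > 0" and cov: "\<And>\<delta>. 0 < \<delta> \<Longrightarrow> \<delta> \<le> 1 \<Longrightarrow>
        (\<exists>\<U>. finite \<U> \<and> A \<subseteq> \<Union>\<U> \<and> (\<forall>U\<in>\<U>. bounded U \<and> diameter U \<le> \<delta>) \<and>
             real (card \<U>) \<le> K * \<delta> powr - s)"
    using assms(1) unfolding covered_at_rate_def by blast
  have small: "hausdorff_premeasure t \<epsilon> A \<le> ennreal (K * \<delta> powr (t - s))"
    if \<delta>: "0 < \<delta>" "\<delta> \<le> 1" "\<delta> \<le> \<epsilon>" for \<delta> \<epsilon>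
  proof -
    obtain \<U> where fin: "finite \<U>" and A: "A \<subseteq> \<Union>\<U>"
      and U: "\<And>U. U \<in> \<U> \<Longrightarrow> bounded U \<and> diameter U \<le> \<delta>"
      and card: "real (card \<U>) \<le> K * \<delta> powr - s"
      using cov[OF \<delta>(1,2)] by blast
    obtain V where V: "\<And>i. i < card \<U> \<Longrightarrow> V i \<in> \<U>"
      and empty: "\<And>i. \<not> i < card \<U> \<Longrightarrow> V i = {}" and union: "(\<Union>i. V i) = \<Union>\<U>"
      using finite_family_as_sequence[OF fin] by blast
    have bdd: "bounded (V i)" "diameter (V i) \<le> \<delta>" for i
      using V U \<delta> empty by (cases "i < card \<U>"; force)+
    have "hausdorff_premeasure t \<epsilon> A \<le> (\<Sum>i. diam_pow t (V i))"
      unfolding hausdorff_premeasure_def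
    proof (rule Inf_lower, rule CollectI, rule exI[of _ V], intro conjI allI refl)
      show "diameter (V i) \<le> \<epsilon>" for i using bdd(2)[of i] \<delta>(3) by linarith
    qed (use A union bdd(1) in simp_all)
    also have "\<dots> = (\<Sum>i<card \<U>. diam_pow t (V i))"
      by (rule suminf_finite) (auto simp: empty diam_pow_def)
    also have "\<dots> \<le> (\<Sum>i<card \<U>. ennreal (\<delta> powr t))"
      by (rule sum_mono)
        (use st bdd in \<open>auto simp: diam_pow_def intro!: ennreal_leI powr_mono2 diameter_ge_0\<close>)
    also have "\<dots> = ennreal (real (card \<U>) * \<delta> powr t)"
      by (simp add: ennreal_mult ennreal_of_nat_eq_real_of_nat)
    also have "\<dots> \<le> ennreal (K * \<delta> powr (t - s))"
    proof (rule ennreal_leI)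
      have "real (card \<U>) * \<delta> powr t \<le> K * \<delta> powr - s * \<delta> powr t"
        using card by (intro mult_right_mono) auto
      then show "real (card \<U>) * \<delta> powr t \<le> K * \<delta> powr (t - s)"
        by (simp add: mult.assoc powr_add[symmetric])
    qed
    finally show ?thesis .
  qed
  have "hausdorff_premeasure t \<epsilon> A = 0" if \<epsilon>: "\<epsilon> > 0" for \<epsilon>
  proof -
    have "((\<lambda>\<delta>. K * \<delta> powr (t - s)) \<longlongrightarrow> K * 0 powr (t - s)) (at_right 0)"
      by (intro tendsto_intros) (use st in \<open>auto simp: eventually_at_filter\<close>)
    then have "((\<lambda>\<delta>. ennreal (K * \<delta> powr (t - s))) \<longlongrightarrow> ennreal 0) (at_right 0)"
      by (intro tendsto_ennrealI) (use st in simp)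
    moreover have "\<forall>\<^sub>F \<delta> in at_right 0. hausdorff_premeasure t \<epsilon> A \<le> ennreal (K * \<delta> powr (t - s))"
      by (rule eventually_mono[OF eventually_at_right_real[of 0 "min 1 \<epsilon>"]])
        (use \<epsilon> in \<open>auto intro: small\<close>)
    ultimately have "hausdorff_premeasure t \<epsilon> A \<le> ennreal 0"
      by (rule tendsto_lowerbound) simp
    then show ?thesis by simp
  qed
  then show ?thesis by (simp add: hausdorff_measure_def)
qed

lemma upper_box_dim_le:
  fixes A :: "'a::metric_space set"
  assumes "covered_at_rate s A" and s: "0 \<le> s"
  shows "upper_box_dim A \<le> ereal s"
proof -
  obtain K where K: "K > 0" and cov: "\<And>\<delta>. 0 < \<delta> \<Longrightarrow> \<delta> \<le> 1 \<Longrightarrow>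
        (\<exists>\<U>. finite \<U> \<and> A \<subseteq> \<Union>\<U> \<and> (\<forall>U\<in>\<U>. bounded U \<and> diameter U \<le> \<delta>) \<and>
             real (card \<U>) \<le> K * \<delta> powr - s)"
    using assms(1) unfolding covered_at_rate_def by blast
  define L where "L = max 1 K"
  have bound: "ln (real (covering_number \<delta> A)) / - ln \<delta> \<le> ln L / - ln \<delta> + s"
    if \<delta>: "0 < \<delta>" "\<delta> < 1" for \<delta>
  proof -
    obtain \<U> where \<U>: "finite \<U>" "A \<subseteq> \<Union>\<U>"
      "\<And>U. U \<in> \<U> \<Longrightarrow> bounded U \<and> diameter U \<le> \<delta>"
      "real (card \<U>) \<le> K * \<delta> powr - s"
      using cov[of \<delta>] \<delta> by force
    have "real (covering_number \<delta> A) \<le> K * \<delta> powr - s"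
      using covering_number_le[OF \<U>(1-3)] \<U>(4) by force
    also have "\<dots> \<le> L * \<delta> powr - s" by (intro mult_right_mono) (auto simp: L_def)
    finally have le: "real (covering_number \<delta> A) \<le> L * \<delta> powr - s" .
    have "ln (real (covering_number \<delta> A)) \<le> ln L + s * - ln \<delta>"
    proof (cases "covering_number \<delta> A = 0")
      case True
      have "s * ln \<delta> \<le> 0" "0 \<le> ln L" using s \<delta> by (auto simp: L_def mult_nonneg_nonpos)
      with True show ?thesis by simp
    next
      case False
      then have "ln (real (covering_number \<delta> A)) \<le> ln (L * \<delta> powr - s)"
        using le \<delta> by (simp add: L_def)
      also have "\<dots> = ln L + s * - ln \<delta>"
        using \<delta> by (simp add: ln_mult ln_powr L_def)
      finally show ?thesis .
    qed
    then have "ln (real (covering_number \<delta> A)) / - ln \<delta> \<le> (ln L + s * - ln \<delta>) / - ln \<delta>"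
      using \<delta> by (intro divide_right_mono) auto
    also have "\<dots> = ln L / - ln \<delta> + s" using \<delta> by (simp add: field_simps)
    finally show ?thesis .
  qed
  have lnlim: "filterlim (\<lambda>\<delta>::real. - ln \<delta>) at_top (at_right 0)"
    using filterlim_uminus_at_top[of "\<lambda>\<delta>::real. - ln \<delta>" "at_right 0"] ln_at_0 by simp
  have "((\<lambda>\<delta>. ln L / - ln \<delta> + s) \<longlongrightarrow> 0 + s) (at_right 0)"
    by (intro tendsto_intros tendsto_divide_0[OF tendsto_const] filterlim_at_top_imp_at_infinity lnlim)
  then have "((\<lambda>\<delta>. ereal (ln L / - ln \<delta> + s)) \<longlongrightarrow> ereal s) (at_right 0)"
    by simp
  then have "Limsup (at_right 0) (\<lambda>\<delta>. ereal (ln L / - ln \<delta> + s)) = ereal s"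
    by (intro lim_imp_Limsup) auto
  moreover have "upper_box_dim A \<le> Limsup (at_right 0) (\<lambda>\<delta>. ereal (ln L / - ln \<delta> + s))"
    unfolding upper_box_dim_def
    by (rule Limsup_mono)
      (use eventually_at_right_real[of "0::real" 1] bound in \<open>auto elim!: eventually_mono\<close>)
  ultimately show ?thesis by simp
qed

lemma one_le_lower_box_dim:
  fixes A :: "'a::euclidean_space set"
  assumes cov: "covered_at_rate s A"
    and e: "norm e = 1" and ab: "a < b" and sub: "{a..b} \<subseteq> (\<lambda>x. x \<bullet> e) ` A"
  shows "1 \<le> lower_box_dim A"
proof -
  have bound: "ln (b - a) / - ln \<delta> + 1 \<le> ln (real (covering_number \<delta> A)) / - ln \<delta>"
    if \<delta>: "0 < \<delta>" "\<delta> < 1" for \<delta>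
  proof -
    obtain \<U> where \<U>: "finite \<U>" "A \<subseteq> \<Union>\<U>"
      "\<And>U. U \<in> \<U> \<Longrightarrow> bounded U \<and> diameter U \<le> \<delta>"
      using cov \<delta> unfolding covered_at_rate_def by (metis less_eq_real_def)
    obtain \<V> where \<V>: "finite \<V>" "card \<V> = covering_number \<delta> A" "A \<subseteq> \<Union>\<V>"
      "\<And>V. V \<in> \<V> \<Longrightarrow> bounded V \<and> diameter V \<le> \<delta>"
      using covering_number_attained[OF \<U>] by blast
    have "b - a \<le> real (card \<V>) * \<delta>"
      by (rule interval_le_card_mult[OF e _ \<V>(1) order_trans[OF sub image_mono[OF \<V>(3)]] \<V>(4)])
        (use ab in auto)
    then have le: "(b - a) / \<delta> \<le> real (covering_number \<delta> A)"
      using \<V>(2) \<delta> by (simp add: divide_simps)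
    have "0 < (b - a) / \<delta>" using ab \<delta> by simp
    then have "ln ((b - a) / \<delta>) \<le> ln (real (covering_number \<delta> A))"
      using le by (subst ln_le_cancel_iff) auto
    then have "(ln (b - a) - ln \<delta>) / - ln \<delta> \<le> ln (real (covering_number \<delta> A)) / - ln \<delta>"
      using ab \<delta> by (intro divide_right_mono) (auto simp: ln_div)
    then show ?thesis using \<delta> by (simp add: diff_divide_distrib)
  qed
  have lnlim: "filterlim (\<lambda>\<delta>::real. - ln \<delta>) at_top (at_right 0)"
    using filterlim_uminus_at_top[of "\<lambda>\<delta>::real. - ln \<delta>" "at_right 0"] ln_at_0 by simp
  have "((\<lambda>\<delta>. ln (b - a) / - ln \<delta> + 1) \<longlongrightarrow> 0 + 1) (at_right 0)"
    by (intro tendsto_intros tendsto_divide_0[OF tendsto_const] filterlim_at_top_imp_at_infinity lnlim)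
  then have "((\<lambda>\<delta>. ereal (ln (b - a) / - ln \<delta> + 1)) \<longlongrightarrow> ereal 1) (at_right 0)"
    by simp
  then have "Liminf (at_right 0) (\<lambda>\<delta>. ereal (ln (b - a) / - ln \<delta> + 1)) = ereal 1"
    by (intro lim_imp_Liminf) auto
  moreover have "Liminf (at_right 0) (\<lambda>\<delta>. ereal (ln (b - a) / - ln \<delta> + 1)) \<le> lower_box_dim A"
    unfolding lower_box_dim_def
    by (rule Liminf_mono)
      (use eventually_at_right_real[of "0::real" 1] bound in \<open>auto elim!: eventually_mono\<close>)
  ultimately show ?thesis by (simp add: one_ereal_def)
qed

text \<open>The coverings give only \<open>\<le> s\<close> for each \<open>s > 1\<close>; letting \<open>s\<close> decrease to 1 meets the lower
  bound that the shadow provides.\<close>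

proposition dimensions_eq_1:
  fixes A :: "'a::euclidean_space set"
  assumes cov: "\<And>s. 1 < s \<Longrightarrow> covered_at_rate s A"
    and proj: "norm e = 1" "a < b" "{a..b} \<subseteq> (\<lambda>x. x \<bullet> e) ` A"
  shows "hausdorff_dim A = 1" "lower_box_dim A = 1" "upper_box_dim A = 1"
proof -
  have above1: "z \<le> 1" if "\<And>s. 1 < s \<Longrightarrow> z \<le> ereal s" for z
  proof (rule dense_ge)
    fix x :: ereal assume "1 < x"
    then show "z \<le> x" using that by (cases x) (auto simp: one_ereal_def)
  qed
  have "hausdorff_dim A \<le> ereal s" if "1 < s" for s
    unfolding hausdorff_dim_def
    by (intro Inf_lower imageI)
      (use hausdorff_measure_eq_0[OF cov, of "(1 + s) / 2" s] that in auto)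
  then show "hausdorff_dim A = 1"
    using one_le_hausdorff_dim[OF proj] above1 by (intro antisym) auto
  have upper: "upper_box_dim A \<le> 1"
    by (rule above1) (use cov in \<open>auto intro!: upper_box_dim_le\<close>)
  have lower: "1 \<le> lower_box_dim A"
    using cov[of 2] proj by (intro one_le_lower_box_dim) auto
  have mid: "lower_box_dim A \<le> upper_box_dim A"
    unfolding lower_box_dim_def upper_box_dim_def by (rule Liminf_le_Limsup) simp
  show "lower_box_dim A = 1" "upper_box_dim A = 1"
    using lower mid upper by auto
qed

section \<open>Similarities and tilings by similar copies\<close>

definition similarity :: "real \<Rightarrow> ('a::metric_space \<Rightarrow> 'a) \<Rightarrow> bool" where
  "similarity r f \<longleftrightarrow> 0 < r \<and> (\<forall>x y. dist (f x) (f y) = r * dist x y)"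

lemma similarity_comp:
  "similarity r f \<Longrightarrow> similarity s g \<Longrightarrow> similarity (r * s) (f \<circ> g)"
  by (simp add: similarity_def)

lemma similarity_affine:
  fixes f :: "'a::euclidean_space \<Rightarrow> 'a"
  assumes "similarity r f"
  obtains T where "orthogonal_transformation T" "f = (\<lambda>x. f 0 + r *\<^sub>R T x)"
proof
  have r: "0 < r" and d: "\<And>x y. dist (f x) (f y) = r * dist x y"
    using assms by (auto simp: similarity_def)
  let ?T = "\<lambda>x. (f x - f 0) /\<^sub>R r"
  have "dist (?T x) (?T y) = dist x y" for x y
  proof -
    have "?T x - ?T y = (f x - f y) /\<^sub>R r"
      by (simp add: scaleR_right_diff_distrib[symmetric])
    then have "dist (?T x) (?T y) = dist (f x) (f y) / r"
      using r by (simp add: dist_norm divide_inverse mult.commute)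
    then show ?thesis using d r by simp
  qed
  then show "orthogonal_transformation ?T"
    by (simp add: orthogonal_transformation_isometry)
  show "f = (\<lambda>x. f 0 + r *\<^sub>R ?T x)" using r by auto
qed

text \<open>This form gives access to the library's results on images of hulls and interiors under injective
  linear maps and translations.\<close>

lemma similarity_eq_translation_linear:
  fixes f :: "'a::euclidean_space \<Rightarrow> 'a"
  assumes "similarity r f"
  obtains c h where "linear h" "inj h" "f = (\<lambda>x. c + x) \<circ> h"
proof -
  obtain T where T: "orthogonal_transformation T" "f = (\<lambda>x. f 0 + r *\<^sub>R T x)"
    using similarity_affine[OF assms] .
  have "r \<noteq> 0" using assms by (simp add: similarity_def)
  then have "inj (\<lambda>x. r *\<^sub>R T x)"
    using orthogonal_transformation_inj[OF T(1)] by (auto simp: inj_def)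
  moreover have "linear (\<lambda>x. r *\<^sub>R T x)"
    by (intro linear_compose_scale_right orthogonal_transformation_linear T)
  moreover have "f = (\<lambda>x. f 0 + x) \<circ> (\<lambda>x. r *\<^sub>R T x)"
    using T(2) by (simp add: comp_def)
  ultimately show ?thesis using that by blast
qed

lemma similarity_image_convex_hull:
  fixes f :: "'a::euclidean_space \<Rightarrow> 'a"
  assumes "similarity r f"
  shows "convex hull (f ` A) = f ` (convex hull A)"
proof -
  obtain c h where h: "linear h" "inj h" "f = (\<lambda>x. c + x) \<circ> h"
    using similarity_eq_translation_linear[OF assms] .
  show ?thesis
    by (simp only: h(3) image_comp[symmetric] convex_hull_translation
        convex_hull_linear_image[OF h(1)])
qed

lemma similarity_image_interior:
  fixes f :: "'a::euclidean_space \<Rightarrow> 'a"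
  assumes "similarity r f"
  shows "interior (f ` A) = f ` interior A"
proof -
  obtain c h where h: "linear h" "inj h" "f = (\<lambda>x. c + x) \<circ> h"
    using similarity_eq_translation_linear[OF assms] .
  show ?thesis
    by (simp only: h(3) image_comp[symmetric] interior_translation
        interior_injective_linear_image[OF h(1,2)])
qed

lemma similarity_inj:
  assumes "similarity r f" shows "inj f"
proof (rule injI)
  fix x y assume "f x = f y"
  then have "r * dist x y = 0" using assms by (metis similarity_def dist_self)
  then show "x = y" using assms by (simp add: similarity_def)
qed

text \<open>The interior of the convex hull serves as the canonical open set of a self-similar set: it is
  determined by the set, is carried along by similarities, and inherits disjointness from any convex
  open set that witnesses the open set condition.\<close>

definition hull_interior :: "'a::euclidean_space set \<Rightarrow> 'a set" where
  "hull_interior A = interior (convex hull A)"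

lemma hull_interior_mono: "A \<subseteq> B \<Longrightarrow> hull_interior A \<subseteq> hull_interior B"
  by (simp add: hull_interior_def hull_mono interior_mono)

lemma hull_interior_similarity:
  "similarity r f \<Longrightarrow> hull_interior (f ` A) = f ` hull_interior A"
  by (simp add: hull_interior_def similarity_image_convex_hull similarity_image_interior)

text \<open>A tiling is a set of pieces rather than of words over \<open>{1..N}\<close>: the counting below only sees the
  pieces as sets, and maps with equal images of \<open>F\<close> may be merged without harm.\<close>

definition tiling :: "'a::euclidean_space set \<Rightarrow> real \<Rightarrow> real \<Rightarrow> 'a set set \<Rightarrow> bool" where
  "tiling F a b \<P> \<longleftrightarrow> finite \<P> \<and> \<Union>\<P> = F \<and>
     (\<forall>A\<in>\<P>. \<exists>f s. similarity s f \<and> a \<le> s \<and> s \<le> b \<and> A = f ` F) \<and>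
     (\<forall>A\<in>\<P>. \<forall>B\<in>\<P>. A \<noteq> B \<longrightarrow> hull_interior A \<inter> hull_interior B = {})"

lemma tilingD:
  assumes "tiling F a b \<P>"
  shows "finite \<P>" "\<Union>\<P> = F"
    and "\<And>A B. A \<in> \<P> \<Longrightarrow> B \<in> \<P> \<Longrightarrow> A \<noteq> B \<Longrightarrow> hull_interior A \<inter> hull_interior B = {}"
  using assms by (simp_all add: tiling_def)

lemma tiling_piece:
  assumes "tiling F a b \<P>" "A \<in> \<P>"
  obtains f s where "similarity s f" "0 < s" "a \<le> s" "s \<le> b" "A = f ` F"
proof -
  have "\<exists>f s. similarity s f \<and> a \<le> s \<and> s \<le> b \<and> A = f ` F"
    using assms by (simp add: tiling_def)
  then show ?thesis using that by (auto simp: similarity_def)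
qed

lemma tiling_self:
  assumes "a \<le> 1" "1 \<le> b" shows "tiling F a b {F}"
  using assms by (auto simp: tiling_def similarity_def intro!: exI[of _ id] exI[of _ 1])

text \<open>Each piece is a copy \<open>f ` F\<close>, so a tiling of \<open>F\<close> can be transported into it by \<open>f\<close>. Two new pieces
  within one old piece have disjoint hull interiors because \<open>f\<close> is injective, and two within
  different old pieces because hull interiors are monotone.\<close>

lemma tiling_refine:
  fixes F :: "'a::euclidean_space set"
  assumes \<P>: "tiling F a b \<P>"
    and fine: "\<And>s. 0 < s \<Longrightarrow> a \<le> s \<Longrightarrow> s \<le> b \<Longrightarrow> \<exists>\<Q>. tiling F (a' / s) (b' / s) \<Q>"
  obtains \<P>' where "tiling F a' b' \<P>'" "\<And>B. B \<in> \<P>' \<Longrightarrow> \<exists>A\<in>\<P>. B \<subseteq> A"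
proof -
  have "\<forall>A\<in>\<P>. \<exists>f s \<Q>. similarity s f \<and> A = f ` F \<and> tiling F (a' / s) (b' / s) \<Q>"
  proof
    fix A assume "A \<in> \<P>"
    then obtain f s where "similarity s f" "0 < s" "a \<le> s" "s \<le> b" "A = f ` F"
      using tiling_piece[OF \<P>] by metis
    then show "\<exists>f s \<Q>. similarity s f \<and> A = f ` F \<and> tiling F (a' / s) (b' / s) \<Q>"
      using fine[of s] by blast
  qed
  then obtain f s \<Q> where f: "\<And>A. A \<in> \<P> \<Longrightarrow> similarity (s A) (f A)"
    and img: "\<And>A. A \<in> \<P> \<Longrightarrow> A = f A ` F"
    and \<Q>: "\<And>A. A \<in> \<P> \<Longrightarrow> tiling F (a' / s A) (b' / s A) (\<Q> A)"
    by metis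
  define \<P>' where "\<P>' = (\<Union>A\<in>\<P>. (`) (f A) ` \<Q> A)"
  have sub: "f A ` B \<subseteq> A" if "A \<in> \<P>" "B \<in> \<Q> A" for A B
  proof -
    have "B \<subseteq> F" using tilingD(2)[OF \<Q>[OF that(1)]] that(2) by blast
    then show ?thesis using img[OF that(1)] by blast
  qed
  have "finite \<P>'"
    using tilingD(1)[OF \<P>] tilingD(1)[OF \<Q>] by (auto simp: \<P>'_def)
  moreover have "\<Union>\<P>' = F"
  proof -
    have "\<Union>\<P>' = (\<Union>A\<in>\<P>. f A ` \<Union>(\<Q> A))" by (auto simp: \<P>'_def)
    also have "\<dots> = (\<Union>A\<in>\<P>. f A ` F)"
      by (rule SUP_cong) (simp_all add: tilingD(2)[OF \<Q>])
    also have "\<dots> = \<Union>\<P>" using img by simp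
    finally show ?thesis using tilingD(2)[OF \<P>] by simp
  qed
  moreover have "\<exists>g t. similarity t g \<and> a' \<le> t \<and> t \<le> b' \<and> B = g ` F" if "B \<in> \<P>'" for B
  proof -
    obtain A C where A: "A \<in> \<P>" and C: "C \<in> \<Q> A" "B = f A ` C"
      using \<open>B \<in> \<P>'\<close> by (auto simp: \<P>'_def)
    obtain g t where g: "similarity t g" "a' / s A \<le> t" "t \<le> b' / s A" "C = g ` F"
      using tiling_piece[OF \<Q>[OF A] C(1)] by metis
    have "0 < s A" using f[OF A] by (simp add: similarity_def)
    then have "a' \<le> s A * t" "s A * t \<le> b'" using g(2,3) by (auto simp: field_simps)
    moreover have "B = (f A \<circ> g) ` F" using C g(4) by auto
    ultimately show ?thesis using similarity_comp[OF f[OF A] g(1)] by blast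
  qed
  moreover have "hull_interior B \<inter> hull_interior B' = {}"
    if "B \<in> \<P>'" "B' \<in> \<P>'" "B \<noteq> B'" for B B'
  proof -
    obtain A C where A: "A \<in> \<P>" and C: "C \<in> \<Q> A" "B = f A ` C"
      using \<open>B \<in> \<P>'\<close> by (auto simp: \<P>'_def)
    obtain A' C' where A': "A' \<in> \<P>" and C': "C' \<in> \<Q> A'" "B' = f A' ` C'"
      using \<open>B' \<in> \<P>'\<close> by (auto simp: \<P>'_def)
    show ?thesis
    proof (cases "A = A'")
      case True
      then have "C \<noteq> C'" using C C' \<open>B \<noteq> B'\<close> by auto
      then have "hull_interior C \<inter> hull_interior C' = {}"
        using tilingD(3)[OF \<Q>[OF A]] C(1) C'(1) True by blast
      then have "f A ` hull_interior C \<inter> f A ` hull_interior C' = {}"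
        using image_Int[OF similarity_inj[OF f[OF A]]] by blast
      then show ?thesis
        using hull_interior_similarity[OF f[OF A]] C(2) C'(2) True by simp
    next
      case False
      then have "hull_interior A \<inter> hull_interior A' = {}"
        using tilingD(3)[OF \<P> A A'] by blast
      moreover have "hull_interior B \<subseteq> hull_interior A" "hull_interior B' \<subseteq> hull_interior A'"
        using sub A A' C C' by (auto intro!: hull_interior_mono)
      ultimately show ?thesis by blast
    qed
  qed
  ultimately have "tiling F a' b' \<P>'" unfolding tiling_def by simp
  moreover have "\<exists>A\<in>\<P>. B \<subseteq> A" if "B \<in> \<P>'" for B
    using that sub unfolding \<P>'_def by blast
  ultimately show ?thesis using that by blast
qed

text \<open>A point \<open>y = S i z\<close> of \<open>F\<close> at maximal distance from \<open>U\<close> satisfies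
  \<open>infdist y U \<le> r i * infdist z U \<le> r i * infdist y U\<close>, which forces this distance to vanish.\<close>

lemma attractor_subset_closure:
  fixes S :: "nat \<Rightarrow> 'a::euclidean_space \<Rightarrow> 'a"
  assumes S: "\<And>i. i \<in> {1..N} \<Longrightarrow> similarity (r i) (S i)"
    and r: "\<And>i. i \<in> {1..N} \<Longrightarrow> r i < 1"
    and F: "is_attractor N S F"
    and U: "U \<noteq> {}" "\<And>i. i \<in> {1..N} \<Longrightarrow> S i ` U \<subseteq> U"
  shows "F \<subseteq> closure U"
proof -
  have F': "compact F" "F \<noteq> {}" "F = (\<Union>i\<in>{1..N}. S i ` F)"
    using F unfolding is_attractor_def by blast+
  have "continuous_on F (\<lambda>x. infdist x U)" by (intro continuous_intros)
  then obtain y where y: "y \<in> F" and max: "\<And>x. x \<in> F \<Longrightarrow> infdist x U \<le> infdist y U"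
    using continuous_attains_sup[OF F'(1,2)] by blast
  obtain i z where i: "i \<in> {1..N}" and z: "z \<in> F" "y = S i z"
    using y F'(3) by blast
  have "infdist y U \<le> r i * dist z u" if "u \<in> U" for u
  proof -
    have "infdist y U \<le> dist y (S i u)" by (rule infdist_le) (use U(2)[OF i] that in blast)
    then show ?thesis using S[OF i] z(2) by (simp add: similarity_def)
  qed
  then have "infdist y U / r i \<le> infdist z U"
    unfolding infdist_notempty[OF U(1)] using U(1) S[OF i]
    by (intro cINF_greatest) (auto simp: similarity_def field_simps infdist_notempty)
  then have "infdist y U \<le> r i * infdist y U"
    using max[OF z(1)] S[OF i] by (simp add: similarity_def field_simps)
       (metis mult_left_mono order_less_imp_le order_trans)
  then have "infdist y U \<le> 0"
    using r[OF i] infdist_nonneg[of y U] by (smt (verit) mult_less_cancel_right2)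
  then have "infdist x U = 0" if "x \<in> F" for x
    using max[OF that] infdist_nonneg[of x U] by linarith
  then show ?thesis using in_closure_iff_infdist_zero[OF U(1)] by blast
qed

text \<open>Since \<open>F\<close> lies in the closure of the convex open set \<open>U\<close>, so does its hull, and the interior of the
  closure of a convex open set is that set. Hence the hull interiors of the pieces lie in the
  disjoint sets \<open>S i ` U\<close>.\<close>

lemma tiling_first_level:
  fixes S :: "nat \<Rightarrow> 'a::euclidean_space \<Rightarrow> 'a"
  assumes S: "\<And>i. i \<in> {1..N} \<Longrightarrow> similarity (r i) (S i)"
    and r: "\<And>i. i \<in> {1..N} \<Longrightarrow> a \<le> r i \<and> r i \<le> b" and "b < 1"
    and F: "is_attractor N S F" and osc: "convex_open_set_condition N S"
  shows "tiling F a b ((\<lambda>i. S i ` F) ` {1..N})"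
proof -
  obtain U where U: "U \<noteq> {}" "convex U" "open U"
    and inv: "\<And>i. i \<in> {1..N} \<Longrightarrow> S i ` U \<subseteq> U"
    and disj: "disjoint_family_on (\<lambda>i. S i ` U) {1..N}"
    using osc unfolding convex_open_set_condition_def by blast
  have "F \<subseteq> closure U"
    by (rule attractor_subset_closure[OF S _ F U(1) inv]) (use r \<open>b < 1\<close> in force)+
  then have hull: "convex hull F \<subseteq> closure U"
    by (intro hull_minimal) (simp_all add: U)
  have sub: "hull_interior (S i ` F) \<subseteq> S i ` U" if i: "i \<in> {1..N}" for i
  proof -
    have "hull_interior F \<subseteq> interior (closure U)"
      unfolding hull_interior_def by (rule interior_mono[OF hull])
    also have "\<dots> = U"
      using convex_interior_closure[OF U(2)] interior_open[OF U(3)] by simp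
    finally show ?thesis using hull_interior_similarity[OF S[OF i]] by blast
  qed
  define \<P> where "\<P> = (\<lambda>i. S i ` F) ` {1..N}"
  have \<P>E: "\<exists>i\<in>{1..N}. A = S i ` F" if "A \<in> \<P>" for A
    using that by (auto simp: \<P>_def)
  have "hull_interior A \<inter> hull_interior B = {}" if AB: "A \<in> \<P>" "B \<in> \<P>" "A \<noteq> B" for A B
  proof -
    obtain i j where i: "i \<in> {1..N}" "A = S i ` F" and j: "j \<in> {1..N}" "B = S j ` F"
      using \<P>E AB by metis
    have "i \<noteq> j" using i j AB by auto
    then have "S i ` U \<inter> S j ` U = {}"
      using disj i j by (simp add: disjoint_family_on_def)
    then show ?thesis using sub[OF i(1)] sub[OF j(1)] i(2) j(2) by blast
  qed
  moreover have "\<Union>\<P> = F"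
    using F unfolding is_attractor_def \<P>_def by simp
  moreover have "\<exists>f s. similarity s f \<and> a \<le> s \<and> s \<le> b \<and> A = f ` F" if "A \<in> \<P>" for A
    using \<P>E[OF that] S r by metis
  moreover have "finite \<P>" by (simp add: \<P>_def)
  ultimately show ?thesis
    unfolding tiling_def \<P>_def[symmetric] by simp
qed

text \<open>The scale \<open>\<delta>\<close> is reached by splitting each first-level piece, of ratio \<open>s\<close>, at the relative scale
  \<open>\<delta> / s\<close>, until this exceeds 1 and the piece is kept. The constant \<open>\<kappa>\<close> is the smallest ratio of
  the system, which suffices because only pieces of ratio at least \<open>\<delta>\<close> are split.\<close>

lemma tilings_at_all_scales:
  fixes S :: "nat \<Rightarrow> 'a::euclidean_space \<Rightarrow> 'a"
  assumes S: "\<forall>i\<in>{1..N}. contracting_similarity (S i)"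
    and F: "is_attractor N S F" and osc: "convex_open_set_condition N S"
  obtains \<kappa> where "0 < \<kappa>" "\<kappa> \<le> 1"
    "\<And>\<delta>. 0 < \<delta> \<Longrightarrow> \<delta> \<le> 1 \<Longrightarrow> \<exists>\<P>. tiling F (\<kappa> * \<delta>) \<delta> \<P>"
proof -
  obtain r where r: "\<And>i. i \<in> {1..N} \<Longrightarrow> similarity (r i) (S i)"
      "\<And>i. i \<in> {1..N} \<Longrightarrow> 0 < r i \<and> r i < 1"
    using S unfolding contracting_similarity_def similarity_def by metis
  have N: "{1..N} \<noteq> {}" using F unfolding is_attractor_def by blast
  define \<kappa> where "\<kappa> = Min (r ` {1..N})"
  define \<mu> where "\<mu> = Max (r ` {1..N})"
  have \<kappa>: "0 < \<kappa>" and \<mu>: "\<mu> < 1"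
    using N r by (auto simp: \<kappa>_def \<mu>_def)
  have bnd: "\<kappa> \<le> r i \<and> r i \<le> \<mu>" if "i \<in> {1..N}" for i
    using that by (auto simp: \<kappa>_def \<mu>_def)
  have \<kappa>\<mu>: "\<kappa> \<le> \<mu>" using N bnd by force
  have first: "tiling F \<kappa> \<mu> ((\<lambda>i. S i ` F) ` {1..N})"
    by (rule tiling_first_level[OF r(1) bnd \<mu> F osc])
  have step: "\<exists>\<P>. tiling F (\<kappa> * \<delta>) \<delta> \<P>" if "0 < \<delta>" "\<delta> \<le> 1" "\<mu> ^ n \<le> \<delta>" for n \<delta>
    using that
  proof (induction n arbitrary: \<delta>)
    case 0
    then show ?case using tiling_self[of "\<kappa> * \<delta>" \<delta> F] \<kappa>\<mu> \<mu> by auto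
  next
    case (Suc n)
    obtain \<P> where "tiling F (\<kappa> * \<delta>) \<delta> \<P>"
    proof (rule tiling_refine[OF first])
      fix s assume s: "0 < s" "\<kappa> \<le> s" "s \<le> \<mu>"
      show "\<exists>\<Q>. tiling F (\<kappa> * \<delta> / s) (\<delta> / s) \<Q>"
      proof (cases "\<delta> \<le> s")
        case True
        have "\<mu> ^ n * s \<le> \<mu> ^ Suc n" using s \<kappa> by (simp add: mult.commute mult_right_mono)
        also have "\<dots> \<le> \<delta>" using Suc.prems by simp
        finally have "\<mu> ^ n \<le> \<delta> / s" using s by (simp add: pos_le_divide_eq)
        then show ?thesis using Suc.IH[of "\<delta> / s"] Suc.prems s True by (simp add: field_simps)
      next
        case False
        have "\<kappa> * \<delta> \<le> s * 1" by (rule mult_mono) (use s \<kappa> Suc.prems in auto)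
        then show ?thesis
          using tiling_self[of "\<kappa> * \<delta> / s" "\<delta> / s" F] s False by (auto simp: field_simps)
      qed
    qed blast
    then show ?case by blast
  qed
  show ?thesis
  proof (rule that[OF \<kappa>])
    show "\<kappa> \<le> 1" using \<kappa>\<mu> \<mu> by simp
    fix \<delta> :: real assume \<delta>: "0 < \<delta>" "\<delta> \<le> 1"
    obtain n where "\<mu> ^ n < \<delta>" using real_arch_pow_inv[OF \<delta>(1) \<mu>] by blast
    then show "\<exists>\<P>. tiling F (\<kappa> * \<delta>) \<delta> \<P>" using step[of \<delta> n] \<delta> by simp
  qed
qed

section \<open>Visible points of a planar set\<close>

text \<open>The vectors \<open>e\<close> (horizontal) and \<open>\<theta>\<close> (vertical, pointing towards the observer) form an
  orthonormal basis of the plane. All the arguments of this part use only these two coordinates.\<close>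

locale plane_frame =
  fixes e \<theta> :: "'a::euclidean_space"
  assumes norm_e: "norm e = 1" and norm_\<theta>: "norm \<theta> = 1" and orth: "\<theta> \<bullet> e = 0"
    and pythagoras: "\<And>x. (norm x)\<^sup>2 = (x \<bullet> e)\<^sup>2 + (x \<bullet> \<theta>)\<^sup>2"
begin

lemma eqI:
  assumes "x \<bullet> e = y \<bullet> e" "x \<bullet> \<theta> = y \<bullet> \<theta>" shows "x = y"
  using pythagoras[of "x - y"] assms by (simp add: inner_diff_left)

lemma coord_diff_le:
  shows "\<bar>x \<bullet> e - y \<bullet> e\<bar> \<le> dist x y" "\<bar>x \<bullet> \<theta> - y \<bullet> \<theta>\<bar> \<le> dist x y"
  using Cauchy_Schwarz_ineq2[of "x - y" e] Cauchy_Schwarz_ineq2[of "x - y" \<theta>] norm_e norm_\<theta>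
  by (simp_all add: inner_diff_left dist_norm)

definition visible :: "'a set \<Rightarrow> 'a set" where
  "visible F = {x \<in> F. \<forall>y\<in>F. y \<bullet> e = x \<bullet> e \<longrightarrow> y \<bullet> \<theta> \<le> x \<bullet> \<theta>}"

lemma projection_visible:
  assumes "compact F"
  shows "(\<lambda>x. x \<bullet> e) ` visible F = (\<lambda>x. x \<bullet> e) ` F"
proof
  show "(\<lambda>x. x \<bullet> e) ` F \<subseteq> (\<lambda>x. x \<bullet> e) ` visible F"
  proof
    fix t assume "t \<in> (\<lambda>x. x \<bullet> e) ` F"
    then obtain x where x: "x \<in> F" "t = x \<bullet> e" by blast
    have "compact (F \<inter> {y. e \<bullet> y = t})"
      using assms closed_hyperplane by (rule compact_Int_closed)
    moreover have "F \<inter> {y. e \<bullet> y = t} \<noteq> {}" using x by (auto simp: inner_commute)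
    moreover have "continuous_on (F \<inter> {y. e \<bullet> y = t}) (\<lambda>y. y \<bullet> \<theta>)" by (intro continuous_intros)
    ultimately obtain v where v: "v \<in> F \<inter> {y. e \<bullet> y = t}"
      "\<And>y. y \<in> F \<inter> {y. e \<bullet> y = t} \<Longrightarrow> y \<bullet> \<theta> \<le> v \<bullet> \<theta>"
      using continuous_attains_sup by metis
    then have "v \<in> visible F" "v \<bullet> e = t" by (auto simp: visible_def inner_commute)
    then show "t \<in> (\<lambda>x. x \<bullet> e) ` visible F" by blast
  qed
qed (auto simp: visible_def)

text \<open>If \<open>q\<close> were below \<open>p\<close> while \<open>y\<close> is above \<open>x\<close>, the segments from \<open>x\<close> to \<open>p\<close> and from \<open>y\<close> to \<open>q\<close> would
  cross at a point that divides both in the same ratio, because corresponding points of the two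
  segments lie on a common vertical line. As \<open>x\<close> and \<open>y\<close> are interior, the crossing point would be
  interior to both hulls. So two hulls with disjoint interiors keep the same vertical order on all
  the lines that meet both.\<close>

lemma vertical_order:
  assumes disj: "hull_interior A \<inter> hull_interior B = {}"
    and x: "x \<in> hull_interior A" and y: "y \<in> hull_interior B"
    and xy: "x \<bullet> e = y \<bullet> e" "x \<bullet> \<theta> < y \<bullet> \<theta>"
    and p: "p \<in> convex hull A" and q: "q \<in> convex hull B" and pq: "p \<bullet> e = q \<bullet> e"
  shows "p \<bullet> \<theta> \<le> q \<bullet> \<theta>"
proof (rule ccontr)
  assume "\<not> p \<bullet> \<theta> \<le> q \<bullet> \<theta>"
  define u where "u = y \<bullet> \<theta> - x \<bullet> \<theta>"
  define w where "w = p \<bullet> \<theta> - q \<bullet> \<theta>"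
  have uw: "0 < u" "0 < w" using xy \<open>\<not> _\<close> by (auto simp: u_def w_def)
  \<comment> \<open>The height difference of corresponding points runs from \<open>u\<close> to \<open>- w\<close> and vanishes here.\<close>
  define s where "s = w / (u + w)"
  have s: "0 < s" "s \<le> 1" "s * u = (1 - s) * w"
    using uw by (auto simp: s_def field_simps)
  have "p - s *\<^sub>R (p - x) \<in> hull_interior A"
    unfolding hull_interior_def
    by (rule mem_interior_convex_shrink) (use x p s in \<open>auto simp: hull_interior_def\<close>)
  moreover have "q - s *\<^sub>R (q - y) \<in> hull_interior B"
    unfolding hull_interior_def
    by (rule mem_interior_convex_shrink) (use y q s in \<open>auto simp: hull_interior_def\<close>)
  moreover have "p - s *\<^sub>R (p - x) = q - s *\<^sub>R (q - y)"
  proof (rule eqI)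
    show "(p - s *\<^sub>R (p - x)) \<bullet> e = (q - s *\<^sub>R (q - y)) \<bullet> e"
      using xy pq by (simp add: inner_diff_left)
    show "(p - s *\<^sub>R (p - x)) \<bullet> \<theta> = (q - s *\<^sub>R (q - y)) \<bullet> \<theta>"
      using s(3) by (simp add: inner_diff_left u_def w_def algebra_simps)
  qed
  ultimately show False using disj by auto
qed

text \<open>An interior point of the hull lies on the line or opposite to \<open>a\<close> or to \<open>b\<close>. The segment from there to
  that point of \<open>A\<close> crosses the line, and all of it but its end in \<open>A\<close> is interior.\<close>

lemma interior_point_on_line:
  assumes ne: "hull_interior A \<noteq> {}" and a: "a \<in> A" "a \<bullet> e < t" and b: "b \<in> A" "t < b \<bullet> e"
  shows "\<exists>z \<in> hull_interior A. z \<bullet> e = t"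
proof -
  obtain c where c: "c \<in> hull_interior A" using ne by blast
  obtain d where d: "d \<in> A" "c \<bullet> e \<le> t \<and> t < d \<bullet> e \<or> d \<bullet> e < t \<and> t \<le> c \<bullet> e"
    using a b by (meson linear)
  define s where "s = (d \<bullet> e - t) / (d \<bullet> e - c \<bullet> e)"
  have s: "0 < s" "s \<le> 1" "s * (d \<bullet> e - c \<bullet> e) = d \<bullet> e - t"
    using d(2) by (auto simp: s_def divide_simps)
  have "d - s *\<^sub>R (d - c) \<in> hull_interior A"
    unfolding hull_interior_def
    by (rule mem_interior_convex_shrink) (use c d s in \<open>auto simp: hull_interior_def hull_inc\<close>)
  moreover have "(d - s *\<^sub>R (d - c)) \<bullet> e = t"
    using s(3) by (simp add: inner_diff_left)
  ultimately show ?thesis by blast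
qed

text \<open>On the line through \<open>v\<close>, the hull of \<open>B\<close> has positive length and separates \<open>A\<close> from \<open>C\<close>, and \<open>C\<close>
  itself, not only its hull, meets the line. So \<open>C\<close> contains a point strictly above \<open>v\<close>. Two pieces
  would not do: \<open>v\<close> may be the only point of the upper piece on the line although its hull extends
  further up.\<close>

lemma lowest_of_three_hidden:
  assumes F: "A \<subseteq> F" "C \<subseteq> F"
    and disj: "hull_interior A \<inter> hull_interior B = {}" "hull_interior B \<inter> hull_interior C = {}"
    and order: "x \<in> hull_interior A" "y \<in> hull_interior B" "z \<in> hull_interior C"
      "x \<bullet> e = y \<bullet> e" "y \<bullet> e = z \<bullet> e" "x \<bullet> \<theta> < y \<bullet> \<theta>" "y \<bullet> \<theta> < z \<bullet> \<theta>"
    and B: "b \<in> B" "b \<bullet> e < v \<bullet> e" "b' \<in> B" "v \<bullet> e < b' \<bullet> e"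
    and C: "v \<bullet> e \<in> (\<lambda>x. x \<bullet> e) ` C"
    and v: "v \<in> A"
  shows "v \<notin> visible F"
proof
  assume vis: "v \<in> visible F"
  obtain w where w: "w \<in> hull_interior B" "w \<bullet> e = v \<bullet> e"
    using interior_point_on_line[OF _ B] order(2) by blast
  obtain \<epsilon> where \<epsilon>: "0 < \<epsilon>" "cball w \<epsilon> \<subseteq> convex hull B"
    using w(1) unfolding hull_interior_def mem_interior_cball by blast
  have ends: "w - \<epsilon> *\<^sub>R \<theta> \<in> convex hull B" "w + \<epsilon> *\<^sub>R \<theta> \<in> convex hull B"
    using \<epsilon> norm_\<theta> by (auto simp: dist_norm intro!: subsetD[OF \<epsilon>(2)])
  have \<theta>: "\<theta> \<bullet> \<theta> = 1" using norm_\<theta> by (simp add: norm_eq_1)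
  obtain c where c: "c \<in> C" "c \<bullet> e = v \<bullet> e" using C by auto
  have "v \<bullet> \<theta> \<le> (w - \<epsilon> *\<^sub>R \<theta>) \<bullet> \<theta>"
    by (rule vertical_order[OF disj(1) order(1,2,4,6)])
      (use v w ends orth in \<open>auto simp: hull_inc inner_diff_left\<close>)
  moreover have "(w + \<epsilon> *\<^sub>R \<theta>) \<bullet> \<theta> \<le> c \<bullet> \<theta>"
    by (rule vertical_order[OF disj(2) order(2,3,5,7)])
      (use c w ends orth in \<open>auto simp: hull_inc inner_add_left\<close>)
  moreover have "c \<bullet> \<theta> \<le> v \<bullet> \<theta>" using vis c F by (auto simp: visible_def)
  ultimately show False using \<epsilon>(1) \<theta> by (simp add: inner_diff_left inner_add_left)
qed

end

section \<open>Counting by cells\<close>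

lemma card_floor_image_le:
  assumes h: "0 < (h::real)" and X: "\<And>x. x \<in> X \<Longrightarrow> a \<le> g x \<and> g x \<le> b" and "a \<le> b"
  shows "finite ((\<lambda>x. \<lfloor>g x / h\<rfloor>) ` X)" "real (card ((\<lambda>x. \<lfloor>g x / h\<rfloor>) ` X)) \<le> (b - a) / h + 2"
proof -
  have sub: "(\<lambda>x. \<lfloor>g x / h\<rfloor>) ` X \<subseteq> {\<lfloor>a / h\<rfloor>..\<lfloor>b / h\<rfloor>}"
    using X h by (auto intro!: floor_mono divide_right_mono)
  then show "finite ((\<lambda>x. \<lfloor>g x / h\<rfloor>) ` X)" by (rule finite_subset) simp
  have le: "\<lfloor>a / h\<rfloor> \<le> \<lfloor>b / h\<rfloor>"
    using h \<open>a \<le> b\<close> by (intro floor_mono divide_right_mono) auto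
  have "real (card ((\<lambda>x. \<lfloor>g x / h\<rfloor>) ` X)) \<le> real (card {\<lfloor>a / h\<rfloor>..\<lfloor>b / h\<rfloor>})"
    using card_mono[OF _ sub] by simp
  also have "\<dots> = of_int \<lfloor>b / h\<rfloor> - of_int \<lfloor>a / h\<rfloor> + 1" using le by simp
  also have "\<dots> \<le> b / h - (a / h - 1) + 1" by linarith
  finally show "real (card ((\<lambda>x. \<lfloor>g x / h\<rfloor>) ` X)) \<le> (b - a) / h + 2"
    by (simp add: diff_divide_distrib)
qed

lemma abs_diff_less_if_floor_eq:
  assumes "0 < (h::real)" "\<lfloor>s / h\<rfloor> = \<lfloor>t / h\<rfloor>" shows "\<bar>s - t\<bar> < h"
proof -
  have "\<bar>s / h - t / h\<bar> < 1" using assms(2) by linarith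
  then have "\<bar>(s - t) / h\<bar> < 1" by (simp add: diff_divide_distrib)
  then show ?thesis using assms(1) by (simp add: abs_divide)
qed

lemma three_increasing_values:
  fixes f :: "'b \<Rightarrow> 'c::linorder"
  assumes "inj_on f X" "3 \<le> card X"
  obtains x y z where "x \<in> X" "y \<in> X" "z \<in> X" "f x < f y" "f y < f z"
proof -
  obtain Y where "Y \<subseteq> X" "card Y = 3" using obtain_subset_with_card_n[OF assms(2)] by metis
  then obtain a b c where abc: "a \<in> X" "b \<in> X" "c \<in> X" "a \<noteq> b" "a \<noteq> c" "b \<noteq> c"
    by (auto simp: card_3_iff)
  then have "f a \<noteq> f b" "f a \<noteq> f c" "f b \<noteq> f c" using assms(1) by (auto dest: inj_onD)
  then show ?thesis using that abc by (metis linorder_neqE)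
qed

context plane_frame
begin

text \<open>A grid of mesh \<open>\<gamma>\<close> has cells of diameter \<open>\<surd>2 \<gamma> < 2 \<gamma>\<close>, so each cell holds at most one of the
  points.\<close>

lemma card_separated_le:
  assumes \<gamma>: "0 < \<gamma>" and sep: "\<And>x y. x \<in> X \<Longrightarrow> y \<in> X \<Longrightarrow> x \<noteq> y \<Longrightarrow> 2 * \<gamma> \<le> dist x y"
    and e: "\<And>x. x \<in> X \<Longrightarrow> a \<le> x \<bullet> e \<and> x \<bullet> e \<le> b" and "a \<le> b"
    and \<theta>: "\<And>x. x \<in> X \<Longrightarrow> c \<le> x \<bullet> \<theta> \<and> x \<bullet> \<theta> \<le> d" and "c \<le> d"
  shows "real (card X) \<le> ((b - a) / \<gamma> + 2) * ((d - c) / \<gamma> + 2)"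
proof -
  define E where "E = (\<lambda>x. \<lfloor>x \<bullet> e / \<gamma>\<rfloor>) ` X"
  define T where "T = (\<lambda>x. \<lfloor>x \<bullet> \<theta> / \<gamma>\<rfloor>) ` X"
  have E: "finite E" "real (card E) \<le> (b - a) / \<gamma> + 2"
    unfolding E_def by (rule card_floor_image_le[OF \<gamma> e \<open>a \<le> b\<close>], assumption)+
  have T: "finite T" "real (card T) \<le> (d - c) / \<gamma> + 2"
    unfolding T_def by (rule card_floor_image_le[OF \<gamma> \<theta> \<open>c \<le> d\<close>], assumption)+
  let ?g = "\<lambda>x. (\<lfloor>x \<bullet> e / \<gamma>\<rfloor>, \<lfloor>x \<bullet> \<theta> / \<gamma>\<rfloor>)"
  have inj: "inj_on ?g X"
  proof (rule inj_onI, rule ccontr)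
    fix x y assume xy: "x \<in> X" "y \<in> X" "?g x = ?g y" "x \<noteq> y"
    then have "\<bar>(x - y) \<bullet> e\<bar> < \<gamma>" "\<bar>(x - y) \<bullet> \<theta>\<bar> < \<gamma>"
      using abs_diff_less_if_floor_eq[OF \<gamma>] by (auto simp: inner_diff_left)
    then have "((x - y) \<bullet> e)\<^sup>2 < \<gamma>\<^sup>2" "((x - y) \<bullet> \<theta>)\<^sup>2 < \<gamma>\<^sup>2"
      using \<gamma> by (metis abs_ge_zero less_eq_real_def power2_abs power_strict_mono zero_less_numeral)+
    then have "(norm (x - y))\<^sup>2 < 2 * \<gamma>\<^sup>2" using pythagoras[of "x - y"] by simp
    moreover have "(2 * \<gamma>)\<^sup>2 \<le> (norm (x - y))\<^sup>2"
      using sep[OF xy(1,2,4)] \<gamma> by (intro power_mono) (auto simp: dist_norm)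
    moreover have "0 < \<gamma>\<^sup>2" "(2 * \<gamma>)\<^sup>2 = 4 * \<gamma>\<^sup>2" using \<gamma> by (simp_all add: power_mult_distrib)
    ultimately show False by linarith
  qed
  have sub: "?g ` X \<subseteq> E \<times> T" by (auto simp: E_def T_def)
  have "card X \<le> card (E \<times> T)"
    using card_mono[OF _ sub] E T card_image[OF inj] by simp
  then have "real (card X) \<le> real (card E) * real (card T)"
    by (metis card_cartesian_product of_nat_le_iff of_nat_mult)
  also have "\<dots> \<le> ((b - a) / \<gamma> + 2) * ((d - c) / \<gamma> + 2)"
    by (rule mult_mono) (use E T \<gamma> \<open>a \<le> b\<close> in auto)
  finally show "real (card X) \<le> ((b - a) / \<gamma> + 2) * ((d - c) / \<gamma> + 2)" .
qed

definition cell :: "real \<Rightarrow> 'a \<Rightarrow> int" where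
  "cell h x = \<lfloor>x \<bullet> e / h\<rfloor>"

lemma coord_less_if_cell_less:
  assumes "0 < h" "cell h x < cell h y" shows "x \<bullet> e < y \<bullet> e"
  using assms floor_mono[of "y \<bullet> e / h" "x \<bullet> e / h"]
  by (force simp: cell_def divide_right_mono not_less intro: ccontr)

text \<open>Packing: the pieces contain disjoint discs of radius \<open>\<gamma>\<close> whose centres lie in a rectangle of width
  \<open>h + 2 d\<close> and height \<open>2 d'\<close>. When \<open>\<gamma>\<close>, \<open>d\<close> and \<open>h\<close> are comparable, the bound is of order \<open>d' / h\<close>, that
  is, a strip no wider than the pieces holds a bounded number of columns of them.\<close>

lemma card_fat_pieces_le:
  assumes \<gamma>: "0 < \<gamma>" and h: "0 < h"
    and disj: "\<And>B B'. B \<in> \<Q> \<Longrightarrow> B' \<in> \<Q> \<Longrightarrow> B \<noteq> B' \<Longrightarrow> hull_interior B \<inter> hull_interior B' = {}"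
    and fat: "\<And>B. B \<in> \<Q> \<Longrightarrow> \<exists>c. ball c \<gamma> \<subseteq> hull_interior B"
    and small: "\<And>B x y. B \<in> \<Q> \<Longrightarrow> x \<in> B \<Longrightarrow> y \<in> B \<Longrightarrow> dist x y \<le> d" "0 \<le> d"
    and sub: "\<And>B. B \<in> \<Q> \<Longrightarrow> B \<subseteq> A" and A: "\<And>x y. x \<in> A \<Longrightarrow> y \<in> A \<Longrightarrow> dist x y \<le> d'" "0 \<le> d'"
    and meets: "\<And>B. B \<in> \<Q> \<Longrightarrow> \<exists>v\<in>B. cell h v = j"
  shows "real (card \<Q>) \<le> ((h + 2 * d) / \<gamma> + 2) * (2 * d' / \<gamma> + 2)"
proof (cases "\<Q> = {}")
  case True
  then show ?thesis using \<gamma> h small(2) A(2) by simp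
next
  case False
  obtain c where c: "\<And>B. B \<in> \<Q> \<Longrightarrow> ball (c B) \<gamma> \<subseteq> hull_interior B" using fat by metis
  have c_in: "c B \<in> hull_interior B" if "B \<in> \<Q>" for B
    using c[OF that] \<gamma> by auto
  have inj: "inj_on c \<Q>" using disj c_in by (fastforce intro!: inj_onI)
  have sep: "2 * \<gamma> \<le> dist x y" if xy: "x \<in> c ` \<Q>" "y \<in> c ` \<Q>" "x \<noteq> y" for x y
  proof (rule ccontr)
    assume "\<not> 2 * \<gamma> \<le> dist x y"
    then have "midpoint x y \<in> ball x \<gamma> \<inter> ball y \<gamma>" by (simp add: dist_midpoint)
    moreover obtain B B' where "B \<in> \<Q>" "B' \<in> \<Q>" "x = c B" "y = c B'" using xy by blast
    ultimately show False using disj[of B B'] c[of B] c[of B'] xy(3) by blast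
  qed
  obtain B0 where "B0 \<in> \<Q>" using False by blast
  then obtain a0 where a0: "a0 \<in> A" using meets sub by blast
  have hull_cball: "c B \<in> cball x r" if B: "B \<in> \<Q>" "B \<subseteq> cball x r" for B x r
  proof -
    have "convex hull B \<subseteq> cball x r" using B(2) by (simp add: hull_minimal)
    then show ?thesis
      using c_in[OF B(1)] interior_subset[of "convex hull B"] unfolding hull_interior_def by blast
  qed
  have e: "of_int j * h - d \<le> x \<bullet> e \<and> x \<bullet> e \<le> (of_int j * h + h) + d" if x: "x \<in> c ` \<Q>" for x
  proof -
    obtain B where B: "B \<in> \<Q>" "x = c B" using x by blast
    obtain v where v: "v \<in> B" "cell h v = j" using meets[OF B(1)] by blast
    have "of_int j \<le> v \<bullet> e / h" "v \<bullet> e / h \<le> of_int j + 1"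
      using v(2) unfolding cell_def by linarith+
    then have "of_int j * h \<le> v \<bullet> e" "v \<bullet> e \<le> of_int j * h + h"
      using h by (simp_all add: field_simps)
    moreover have "dist v x \<le> d"
      using hull_cball[of B v d] small(1)[OF B(1) v(1)] B by (auto simp: subset_iff)
    ultimately show ?thesis using coord_diff_le(1)[of v x] by linarith
  qed
  have t: "a0 \<bullet> \<theta> - d' \<le> x \<bullet> \<theta> \<and> x \<bullet> \<theta> \<le> a0 \<bullet> \<theta> + d'" if x: "x \<in> c ` \<Q>" for x
  proof -
    obtain B where B: "B \<in> \<Q>" "x = c B" using x by blast
    have "dist a0 x \<le> d'"
      using hull_cball[of B a0 d'] A(1)[OF a0] sub[OF B(1)] B by (auto simp: subset_iff)
    then show ?thesis using coord_diff_le(2)[of a0 x] by linarith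
  qed
  have "real (card (c ` \<Q>)) \<le>
      (((of_int j * h + h) + d - (of_int j * h - d)) / \<gamma> + 2) *
      ((a0 \<bullet> \<theta> + d' - (a0 \<bullet> \<theta> - d')) / \<gamma> + 2)"
    using h small(2) A(2) by (intro card_separated_le[OF \<gamma> sep e _ t]) auto
  then show ?thesis using card_image[OF inj] by (simp add: algebra_simps)
qed

definition visible_pairs :: "real \<Rightarrow> 'a set \<Rightarrow> 'a set set \<Rightarrow> ('a set \<times> int) set" where
  "visible_pairs h F \<P> = {(A, j). A \<in> \<P> \<and> (\<exists>v\<in>A \<inter> visible F. cell h v = j)}"

definition visible_pieces :: "'a set \<Rightarrow> 'a set set \<Rightarrow> 'a set set" where
  "visible_pieces F \<P> = {A \<in> \<P>. A \<inter> visible F \<noteq> {}}"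

text \<open>Points of \<open>A\<close> beyond both sides of the strip \<open>j\<close>, and a convex projection, make \<open>A\<close> meet every
  vertical line in the strip, with room to spare for interior points of the hull.\<close>

definition crosses :: "real \<Rightarrow> 'a set \<Rightarrow> int \<Rightarrow> bool" where
  "crosses h A j \<longleftrightarrow> (\<exists>a\<in>A. cell h a < j) \<and> (\<exists>a\<in>A. j < cell h a)"

lemma crosses_coords:
  assumes "crosses h A j" "0 < h" "cell h v = j"
  obtains a b where "a \<in> A" "a \<bullet> e < v \<bullet> e" "b \<in> A" "v \<bullet> e < b \<bullet> e"
  using assms coord_less_if_cell_less unfolding crosses_def by metis

text \<open>Pieces that cross a common strip are linearly ordered by height. If there were three, the lowest
  would be hidden throughout the strip.\<close>

lemma card_crossing_le_2:
  assumes h: "0 < h" and F: "\<Union>\<P> \<subseteq> F"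
    and disj: "\<And>A B. A \<in> \<P> \<Longrightarrow> B \<in> \<P> \<Longrightarrow> A \<noteq> B \<Longrightarrow> hull_interior A \<inter> hull_interior B = {}"
    and ne: "\<And>A. A \<in> \<P> \<Longrightarrow> hull_interior A \<noteq> {}"
    and proj: "\<And>A. A \<in> \<P> \<Longrightarrow> convex ((\<lambda>x. x \<bullet> e) ` A)"
  shows "card {A. (A, j) \<in> visible_pairs h F \<P> \<and> crosses h A j} \<le> 2" (is "card ?X \<le> 2")
proof (rule ccontr)
  assume "\<not> card ?X \<le> 2"
  define X where "X = ?X"
  have card: "3 \<le> card X" using \<open>\<not> card ?X \<le> 2\<close> by (simp add: X_def)
  have X: "A \<in> \<P>" "crosses h A j" "\<exists>v\<in>A \<inter> visible F. cell h v = j" if "A \<in> X" for A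
    using that by (auto simp: X_def visible_pairs_def)
  have "X \<noteq> {}" using card by auto
  then obtain v0 where v0: "cell h v0 = j" using X(3) by blast
  have "\<exists>z. z \<in> hull_interior A \<and> z \<bullet> e = v0 \<bullet> e" if A: "A \<in> X" for A
  proof -
    obtain a b where "a \<in> A" "a \<bullet> e < v0 \<bullet> e" "b \<in> A" "v0 \<bullet> e < b \<bullet> e"
      using crosses_coords[OF X(2)[OF A] h v0] .
    from interior_point_on_line[OF ne[OF X(1)[OF A]] this] show ?thesis by blast
  qed
  then have "\<exists>z. \<forall>A\<in>X. z A \<in> hull_interior A \<and> z A \<bullet> e = v0 \<bullet> e" by (intro bchoice) blast
  then obtain z where z: "\<And>A. A \<in> X \<Longrightarrow> z A \<in> hull_interior A"
    "\<And>A. A \<in> X \<Longrightarrow> z A \<bullet> e = v0 \<bullet> e" by blast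
  have "inj_on (\<lambda>A. z A \<bullet> \<theta>) X"
  proof (rule inj_onI, rule ccontr)
    fix A B assume AB: "A \<in> X" "B \<in> X" "z A \<bullet> \<theta> = z B \<bullet> \<theta>" "A \<noteq> B"
    have "z A = z B" using z(2)[OF AB(1)] z(2)[OF AB(2)] AB(3) by (intro eqI) simp_all
    then show False
      using z(1)[OF AB(1)] z(1)[OF AB(2)] disj[OF X(1)[OF AB(1)] X(1)[OF AB(2)] AB(4)] by auto
  qed
  from three_increasing_values[OF this card] obtain A B C
    where ABC: "A \<in> X" "B \<in> X" "C \<in> X" "z A \<bullet> \<theta> < z B \<bullet> \<theta>" "z B \<bullet> \<theta> < z C \<bullet> \<theta>" .
  obtain v where v: "v \<in> A" "v \<in> visible F" "cell h v = j" using X(3)[OF ABC(1)] by blast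
  obtain b b' where b: "b \<in> B" "b \<bullet> e < v \<bullet> e" "b' \<in> B" "v \<bullet> e < b' \<bullet> e"
    using crosses_coords[OF X(2)[OF ABC(2)] h v(3)] .
  obtain c c' where c: "c \<in> C" "c \<bullet> e < v \<bullet> e" "c' \<in> C" "v \<bullet> e < c' \<bullet> e"
    using crosses_coords[OF X(2)[OF ABC(3)] h v(3)] .
  have "is_interval ((\<lambda>x. x \<bullet> e) ` C)"
    using proj[OF X(1)[OF ABC(3)]] by (simp add: is_interval_convex_1)
  moreover have "c \<bullet> e \<in> (\<lambda>x. x \<bullet> e) ` C" "c' \<bullet> e \<in> (\<lambda>x. x \<bullet> e) ` C" using c by auto
  ultimately have C: "v \<bullet> e \<in> (\<lambda>x. x \<bullet> e) ` C"
    using c(2,4) unfolding is_interval_1 by (meson less_imp_le)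
  have AC: "A \<subseteq> F" "C \<subseteq> F" using F X(1)[OF ABC(1)] X(1)[OF ABC(3)] by blast+
  have "A \<noteq> B" "B \<noteq> C" using ABC(4,5) by auto
  then have "hull_interior A \<inter> hull_interior B = {}" "hull_interior B \<inter> hull_interior C = {}"
    using disj[OF X(1) X(1)] ABC(1-3) by simp_all
  from lowest_of_three_hidden[OF AC this z(1)[OF ABC(1)] z(1)[OF ABC(2)] z(1)[OF ABC(3)] _ _
      ABC(4,5) b C v(1)]
  have "v \<notin> visible F" using z(2)[OF ABC(1)] z(2)[OF ABC(2)] z(2)[OF ABC(3)] by simp
  then show False using v(2) by simp
qed

text \<open>A pair that is not crossing involves the leftmost or the rightmost strip that its piece meets. So
  there are at most two of these for each visible piece, and at most two crossing pairs for each
  strip. It matters that the strips contribute to the total by a sum and not by a product with the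
  number of visible pieces.\<close>

lemma card_visible_pairs_le:
  assumes h: "0 < h" and F: "\<Union>\<P> = F" and fin: "finite \<P>" and cells: "finite (cell h ` F)"
    and disj: "\<And>A B. A \<in> \<P> \<Longrightarrow> B \<in> \<P> \<Longrightarrow> A \<noteq> B \<Longrightarrow> hull_interior A \<inter> hull_interior B = {}"
    and ne: "\<And>A. A \<in> \<P> \<Longrightarrow> hull_interior A \<noteq> {}"
    and proj: "\<And>A. A \<in> \<P> \<Longrightarrow> convex ((\<lambda>x. x \<bullet> e) ` A)"
  shows "finite (visible_pairs h F \<P>)"
    "card (visible_pairs h F \<P>) \<le> 2 * card (cell h ` F) + 2 * card (visible_pieces F \<P>)"
proof -
  let ?V = "visible_pieces F \<P>"
  define X where "X j = {A. (A, j) \<in> visible_pairs h F \<P> \<and> crosses h A j}" for j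
  have finV: "finite ?V" using fin by (simp add: visible_pieces_def)
  have finX: "finite (X j)" for j
    using fin by (rule finite_subset[rotated]) (auto simp: X_def visible_pairs_def)
  let ?C = "\<Union>j\<in>cell h ` F. (\<lambda>A. (A, j)) ` X j"
  let ?L = "(\<lambda>A. (A, Min (cell h ` A))) ` ?V"
  let ?R = "(\<lambda>A. (A, Max (cell h ` A))) ` ?V"
  have sub: "visible_pairs h F \<P> \<subseteq> ?C \<union> (?L \<union> ?R)"
  proof
    fix P assume P: "P \<in> visible_pairs h F \<P>"
    then obtain A v where Av: "P = (A, cell h v)" "A \<in> \<P>" "v \<in> A" "v \<in> visible F"
      by (auto simp: visible_pairs_def)
    have AF: "A \<subseteq> F" using F Av(2) by blast
    have finA: "finite (cell h ` A)" using cells by (rule finite_subset[rotated]) (use AF in blast)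
    have AV: "A \<in> ?V" using Av by (auto simp: visible_pieces_def)
    consider "crosses h A (cell h v)" | "\<forall>a\<in>A. cell h v \<le> cell h a" | "\<forall>a\<in>A. cell h a \<le> cell h v"
      unfolding crosses_def by force
    then show "P \<in> ?C \<union> (?L \<union> ?R)"
    proof cases
      case 1
      then have "A \<in> X (cell h v)" using P Av(1) by (simp add: X_def)
      then show ?thesis using Av(1,3) AF by blast
    next
      case 2
      then have "Min (cell h ` A) = cell h v" by (intro Min_eqI) (use finA Av in auto)
      then show ?thesis using AV Av(1) by force
    next
      case 3
      then have "Max (cell h ` A) = cell h v" by (intro Max_eqI) (use finA Av in auto)
      then show ?thesis using AV Av(1) by force
    qed
  qed
  have finC: "finite ?C" using cells finX by blast
  show "finite (visible_pairs h F \<P>)"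
    using finite_subset[OF sub] finC finV by blast
  have "card ?C \<le> (\<Sum>j\<in>cell h ` F. card ((\<lambda>A. (A, j)) ` X j))" by (rule card_UN_le[OF cells])
  also have "\<dots> \<le> (\<Sum>j\<in>cell h ` F. 2)"
  proof (rule sum_mono)
    fix j
    have "card ((\<lambda>A. (A, j)) ` X j) \<le> card (X j)" by (rule card_image_le[OF finX])
    also have "\<dots> \<le> 2" unfolding X_def
      by (rule card_crossing_le_2[OF h _ disj ne proj]) (use F in auto)
    finally show "card ((\<lambda>A. (A, j)) ` X j) \<le> 2" .
  qed
  finally have C: "card ?C \<le> 2 * card (cell h ` F)" by simp
  have "card (?L \<union> ?R) \<le> card ?V + card ?V"
    using card_Un_le[of ?L ?R] card_image_le[OF finV, of "\<lambda>A. (A, Min (cell h ` A))"]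
      card_image_le[OF finV, of "\<lambda>A. (A, Max (cell h ` A))"] by linarith
  then have "card (?C \<union> (?L \<union> ?R)) \<le> 2 * card (cell h ` F) + 2 * card ?V"
    using C card_Un_le[of ?C "?L \<union> ?R"] by linarith
  moreover have "card (visible_pairs h F \<P>) \<le> card (?C \<union> (?L \<union> ?R))"
    by (rule card_mono[OF _ sub]) (use finC finV in blast)
  ultimately show "card (visible_pairs h F \<P>) \<le> 2 * card (cell h ` F) + 2 * card ?V"
    by linarith
qed

end

section \<open>Self-similar sets whose pieces project onto intervals\<close>

lemma similarity_ball_subset:
  fixes f :: "'a::euclidean_space \<Rightarrow> 'a"
  assumes f: "similarity s f"
  shows "ball (f c) (s * \<beta>) \<subseteq> f ` ball c \<beta>"
proof
  fix y assume y: "y \<in> ball (f c) (s * \<beta>)"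
  have s: "0 < s" using f by (simp add: similarity_def)
  obtain T where T: "orthogonal_transformation T" "f = (\<lambda>x. f 0 + s *\<^sub>R T x)"
    using similarity_affine[OF f] .
  obtain x where "T x = (y - f 0) /\<^sub>R s"
    using orthogonal_transformation_surj[OF T(1)] by (metis surjD)
  then have "f x = y" using s by (subst T(2)) simp
  moreover have "s * dist c x < s * \<beta>"
    using y f \<open>f x = y\<close> by (auto simp: similarity_def)
  ultimately show "y \<in> f ` ball c \<beta>" using s by auto
qed

text \<open>What the count needs to know about \<open>F\<close> and the fixed direction \<open>\<theta>\<close>. The projections of all
  similar copies of \<open>F\<close> along \<open>\<theta>\<close> amount to the projections of \<open>F\<close> in other directions, which is why
  all directions enter into the result for a single one.\<close>

locale self_similar_frame = plane_frame e \<theta>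
  for e \<theta> :: "'a::euclidean_space" +
  fixes F :: "'a set" and \<kappa> :: real
  assumes compact: "compact F" and hull_interior_ne: "hull_interior F \<noteq> {}"
    and \<kappa>: "0 < \<kappa>" "\<kappa> \<le> 1"
    and tilings: "\<And>\<delta>. 0 < \<delta> \<Longrightarrow> \<delta> \<le> 1 \<Longrightarrow> \<exists>\<P>. tiling F (\<kappa> * \<delta>) \<delta> \<P>"
    and proj_convex: "\<And>r f. similarity r f \<Longrightarrow> convex ((\<lambda>x. x \<bullet> e) ` f ` F)"
begin

lemma tiling_refinement:
  assumes \<P>: "tiling F (\<kappa> * \<delta>) \<delta> \<P>" and \<rho>: "0 < \<rho>" "\<rho> \<le> \<kappa>" and \<delta>: "0 < \<delta>"
  obtains \<P>' where "tiling F (\<kappa> * (\<rho> * \<delta>)) (\<rho> * \<delta>) \<P>'" "\<And>B. B \<in> \<P>' \<Longrightarrow> \<exists>A\<in>\<P>. B \<subseteq> A"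
proof (rule tiling_refine[OF \<P>])
  fix s assume s: "0 < s" "\<kappa> * \<delta> \<le> s" "s \<le> \<delta>"
  have "\<rho> * \<delta> \<le> \<kappa> * \<delta>" using \<rho> \<delta> by (intro mult_right_mono) auto
  then have "\<rho> * \<delta> \<le> s" using s(2) by (rule order_trans)
  then have "\<rho> * \<delta> / s \<le> 1" using s(1) by simp
  then show "\<exists>\<Q>. tiling F (\<kappa> * (\<rho> * \<delta>) / s) (\<rho> * \<delta> / s) \<Q>"
    using tilings[of "\<rho> * \<delta> / s"] s \<rho> \<delta> by simp
qed (rule that)

lemma tiling_piece_diam:
  assumes \<P>: "tiling F a b \<P>" and A: "A \<in> \<P>" "x \<in> A" "y \<in> A"
    and D: "\<And>x y. x \<in> F \<Longrightarrow> y \<in> F \<Longrightarrow> dist x y \<le> D"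
  shows "dist x y \<le> D * b"
proof -
  obtain f s where f: "similarity s f" "0 < s" "a \<le> s" "s \<le> b" "A = f ` F"
    using tiling_piece[OF \<P> A(1)] .
  obtain u v where uv: "u \<in> F" "x = f u" "v \<in> F" "y = f v" using A f(5) by blast
  have "dist x y = s * dist u v" using f(1) uv by (simp add: similarity_def)
  also have "\<dots> \<le> b * D" using f D[OF uv(1,3)] by (intro mult_mono) auto
  finally show ?thesis by (simp add: mult.commute)
qed

lemma tiling_piece_fat:
  assumes \<P>: "tiling F a b \<P>" and A: "A \<in> \<P>"
    and \<beta>: "ball c \<beta> \<subseteq> hull_interior F" "0 \<le> \<beta>"
  shows "\<exists>c'. ball c' (a * \<beta>) \<subseteq> hull_interior A"
proof -
  obtain f s where f: "similarity s f" "0 < s" "a \<le> s" "s \<le> b" "A = f ` F"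
    using tiling_piece[OF \<P> A] .
  have "ball (f c) (a * \<beta>) \<subseteq> ball (f c) (s * \<beta>)"
    using f(3) \<beta>(2) by (intro subset_ball mult_right_mono)
  also have "\<dots> \<subseteq> f ` ball c \<beta>" by (rule similarity_ball_subset[OF f(1)])
  also have "\<dots> \<subseteq> hull_interior A"
    using \<beta>(1) hull_interior_similarity[OF f(1)] f(5) by blast
  finally show ?thesis by blast
qed

lemma tiling_piece_props:
  assumes \<P>: "tiling F a b \<P>" and A: "A \<in> \<P>"
  shows "hull_interior A \<noteq> {}" "convex ((\<lambda>x. x \<bullet> e) ` A)"
proof -
  obtain f s where f: "similarity s f" "A = f ` F"
    using tiling_piece[OF \<P> A] by metis
  show "hull_interior A \<noteq> {}"
    using hull_interior_similarity[OF f(1)] hull_interior_ne f(2) by simp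
  show "convex ((\<lambda>x. x \<bullet> e) ` A)"
    using proj_convex[OF f(1)] f(2) by simp
qed

text \<open>A piece of the finer tiling that is visible contains a visible point, which lies in some strip and
  in some visible piece of the coarser tiling. With strips as wide as the finer scale \<open>\<rho> \<delta>\<close>, each
  pair accounts for at most \<open>O(1 / \<rho>)\<close> finer pieces, and there are \<open>O(1 / (\<rho> \<delta>))\<close> strips. What
  matters is that \<open>C\<close> does not depend on \<open>\<rho>\<close>.\<close>

lemma card_visible_pieces_step:
  obtains C where "1 \<le> C"
    "\<And>\<rho> \<delta> \<P> \<P>'. 0 < \<rho> \<Longrightarrow> \<rho> \<le> 1 \<Longrightarrow> 0 < \<delta> \<Longrightarrow> \<delta> \<le> 1 \<Longrightarrow>
       tiling F (\<kappa> * \<delta>) \<delta> \<P> \<Longrightarrow> tiling F (\<kappa> * (\<rho> * \<delta>)) (\<rho> * \<delta>) \<P>' \<Longrightarrow>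
       (\<And>B. B \<in> \<P>' \<Longrightarrow> \<exists>A\<in>\<P>. B \<subseteq> A) \<Longrightarrow>
       real (card (visible_pieces F \<P>')) \<le>
         C / \<rho> * (1 / (\<rho> * \<delta>) + real (card (visible_pieces F \<P>)))"
proof -
  obtain D where D: "0 \<le> D" "\<And>x y. x \<in> F \<Longrightarrow> y \<in> F \<Longrightarrow> dist x y \<le> D"
    using bounded_two_points[of F] compact_imp_bounded[OF compact]
    by (metis diameter_bounded_bound diameter_ge_0)
  obtain c0 \<beta> where \<beta>: "0 < \<beta>" "ball c0 \<beta> \<subseteq> hull_interior F"
  proof -
    obtain c0 where "c0 \<in> hull_interior F" using hull_interior_ne by blast
    moreover have "open (hull_interior F)" by (simp add: hull_interior_def)
    ultimately show ?thesis using that open_contains_ball by metis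
  qed
  obtain x0 where x0: "x0 \<in> F"
    using hull_interior_ne by (cases "F = {}") (auto simp: hull_interior_def)
  define C1 where "C1 = (1 + 2 * D) / (\<kappa> * \<beta>) + 2"
  define C2 where "C2 = 2 * D / (\<kappa> * \<beta>) + 2"
  have C12: "1 \<le> C1" "1 \<le> C2" using D \<kappa> \<beta> by (auto simp: C1_def C2_def)
  define C where "C = (4 * D + 4) * (C1 * C2)"
  have "1 * (1 * 1) \<le> C" unfolding C_def using D C12 by (intro mult_mono) auto
  then have "1 \<le> C" by simp
  moreover have "real (card (visible_pieces F \<P>')) \<le>
         C / \<rho> * (1 / (\<rho> * \<delta>) + real (card (visible_pieces F \<P>)))"
    if \<rho>: "0 < \<rho>" "\<rho> \<le> 1" and \<delta>: "0 < \<delta>" "\<delta> \<le> 1"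
      and \<P>: "tiling F (\<kappa> * \<delta>) \<delta> \<P>" and \<P>': "tiling F (\<kappa> * (\<rho> * \<delta>)) (\<rho> * \<delta>) \<P>'"
      and refines: "\<And>B. B \<in> \<P>' \<Longrightarrow> \<exists>A\<in>\<P>. B \<subseteq> A" for \<rho> \<delta> \<P> \<P>'
  proof -
    define h where "h = \<rho> * \<delta>"
    have h: "0 < h" "h \<le> 1" using \<rho> \<delta> by (auto simp: h_def intro: mult_le_one)
    define \<gamma> where "\<gamma> = \<kappa> * h * \<beta>"
    have \<gamma>: "0 < \<gamma>" using \<kappa> h \<beta> by (simp add: \<gamma>_def)
    \<comment> \<open>The finer pieces that the pair of a coarse piece and a strip accounts for.\<close>
    define \<Q> where "\<Q> P = {B \<in> \<P>'. B \<subseteq> fst P \<and> (\<exists>v\<in>B. cell h v = snd P)}" for P :: "'a set \<times> int"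
    have fin\<P>': "finite \<P>'" by (rule tilingD(1)[OF \<P>'])
    have fibre: "real (card (\<Q> P)) \<le> C1 * C2 / \<rho>" if P: "fst P \<in> \<P>" for P
    proof -
      have "real (card (\<Q> P)) \<le> ((h + 2 * (D * h)) / \<gamma> + 2) * (2 * (D * \<delta>) / \<gamma> + 2)"
      proof (rule card_fat_pieces_le[OF \<gamma> h(1), where A = "fst P" and j = "snd P"])
        show "hull_interior B \<inter> hull_interior B' = {}" if "B \<in> \<Q> P" "B' \<in> \<Q> P" "B \<noteq> B'" for B B'
          using tilingD(3)[OF \<P>'] that by (simp add: \<Q>_def)
        show "\<exists>c. ball c \<gamma> \<subseteq> hull_interior B" if "B \<in> \<Q> P" for B
          using tiling_piece_fat[OF \<P>' _ \<beta>(2)] \<beta>(1) that by (simp add: \<Q>_def \<gamma>_def h_def)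
        show "dist x y \<le> D * h" if "B \<in> \<Q> P" "x \<in> B" "y \<in> B" for B x y
          using tiling_piece_diam[OF \<P>' _ that(2,3) D(2)] that(1) by (simp add: \<Q>_def h_def)
        show "dist x y \<le> D * \<delta>" if "x \<in> fst P" "y \<in> fst P" for x y
          using tiling_piece_diam[OF \<P> P that D(2)] .
      qed (use D h \<delta> in \<open>auto simp: \<Q>_def\<close>)
      also have "(h + 2 * (D * h)) / \<gamma> + 2 = C1"
      proof -
        have "(h + 2 * (D * h)) / \<gamma> = (h * (1 + 2 * D)) / (h * (\<kappa> * \<beta>))"
          by (simp add: \<gamma>_def algebra_simps)
        then show ?thesis using h by (simp add: C1_def)
      qed
      also have "2 * (D * \<delta>) / \<gamma> + 2 = 2 * D / (\<kappa> * \<beta>) / \<rho> + 2"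
      proof -
        have "2 * (D * \<delta>) / \<gamma> = (\<delta> * (2 * D)) / (\<delta> * (\<kappa> * \<beta> * \<rho>))"
          by (simp add: \<gamma>_def h_def algebra_simps)
        then show ?thesis using \<delta> by simp
      qed
      also have "\<dots> \<le> C2 / \<rho>"
        using \<rho> by (simp add: C2_def add_divide_distrib pos_le_divide_eq)
      finally show ?thesis using C12 by (simp add: mult_left_mono)
    qed
    let ?P = "visible_pairs h F \<P>"
    have cellF: "finite (cell h ` F)" "real (card (cell h ` F)) \<le> (2 * D + 2) / h"
    proof -
      have rng: "x0 \<bullet> e - D \<le> x \<bullet> e \<and> x \<bullet> e \<le> x0 \<bullet> e + D" if "x \<in> F" for x
        using coord_diff_le(1)[of x0 x] D(2)[OF x0 that] by linarith
      show "finite (cell h ` F)"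
        unfolding cell_def by (rule card_floor_image_le(1)[OF h(1) rng]) (use D(1) in auto)
      have "real (card (cell h ` F)) \<le> (x0 \<bullet> e + D - (x0 \<bullet> e - D)) / h + 2"
        unfolding cell_def by (rule card_floor_image_le(2)[OF h(1) rng]) (use D(1) in auto)
      also have "\<dots> \<le> 2 * D / h + 2 / h" using h by (simp add: pos_le_divide_eq)
      finally show "real (card (cell h ` F)) \<le> (2 * D + 2) / h" by (simp add: add_divide_distrib)
    qed
    have pairs: "finite ?P" "card ?P \<le> 2 * card (cell h ` F) + 2 * card (visible_pieces F \<P>)"
      using card_visible_pairs_le[OF h(1) tilingD(2)[OF \<P>] tilingD(1)[OF \<P>] cellF(1)
          tilingD(3)[OF \<P>] tiling_piece_props[OF \<P>]] by simp_all
    have "real (card ?P) \<le> 2 * ((2 * D + 2) / h) + 2 * real (card (visible_pieces F \<P>))"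
      using pairs(2) cellF(2) by linarith
    also have "\<dots> = (4 * D + 4) * (1 / h) + 2 * real (card (visible_pieces F \<P>))"
      by (simp add: field_simps)
    also have "\<dots> \<le> (4 * D + 4) * (1 / h) + (4 * D + 4) * real (card (visible_pieces F \<P>))"
      using D(1) by (intro add_left_mono mult_right_mono) auto
    finally have cardP: "real (card ?P) \<le> (4 * D + 4) * (1 / h + real (card (visible_pieces F \<P>)))"
      by (simp add: distrib_left)
    have "visible_pieces F \<P>' \<subseteq> (\<Union>P\<in>?P. \<Q> P)"
    proof
      fix B assume B: "B \<in> visible_pieces F \<P>'"
      then obtain v where v: "B \<in> \<P>'" "v \<in> B" "v \<in> visible F"
        by (auto simp: visible_pieces_def)
      obtain A where "A \<in> \<P>" "B \<subseteq> A" using refines[OF v(1)] by blast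
      then have "(A, cell h v) \<in> ?P" "B \<in> \<Q> (A, cell h v)"
        using v by (auto simp: visible_pairs_def \<Q>_def)
      then show "B \<in> (\<Union>P\<in>?P. \<Q> P)" by blast
    qed
    then have "card (visible_pieces F \<P>') \<le> card (\<Union>P\<in>?P. \<Q> P)"
      by (rule card_mono[rotated]) (use pairs(1) fin\<P>' in \<open>auto simp: \<Q>_def\<close>)
    also have "\<dots> \<le> (\<Sum>P\<in>?P. card (\<Q> P))" by (rule card_UN_le[OF pairs(1)])
    finally have "real (card (visible_pieces F \<P>')) \<le> (\<Sum>P\<in>?P. real (card (\<Q> P)))"
      by (simp flip: of_nat_sum)
    also have "\<dots> \<le> (\<Sum>P\<in>?P. C1 * C2 / \<rho>)"
      by (rule sum_mono, rule fibre) (auto simp: visible_pairs_def)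
    also have "\<dots> = real (card ?P) * (C1 * C2 / \<rho>)" by simp
    also have "\<dots> \<le> (4 * D + 4) * (1 / h + real (card (visible_pieces F \<P>))) * (C1 * C2 / \<rho>)"
      using cardP C12 \<rho> by (intro mult_right_mono) auto
    also have "\<dots> = C / \<rho> * (1 / (\<rho> * \<delta>) + real (card (visible_pieces F \<P>)))"
      by (simp add: C_def h_def)
    finally show ?thesis .
  qed
  ultimately show ?thesis using that by blast
qed

text \<open>Iterating the step with a fixed factor \<open>\<rho>\<close>: the contribution \<open>1 / \<rho>\<^sup>m\<^sup>+\<^sup>1\<close> of the strips grows no faster
  than the bound itself, so it only costs the factor 2.\<close>

lemma card_visible_pieces_growth:
  obtains C where "1 \<le> C"
    "\<And>\<rho> m. 0 < \<rho> \<Longrightarrow> \<rho> \<le> \<kappa> \<Longrightarrow> \<exists>\<P>. tiling F (\<kappa> * \<rho> ^ m) (\<rho> ^ m) \<P> \<and>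
       real (card (visible_pieces F \<P>)) \<le> 1 / \<rho> * (2 * C / \<rho>) ^ m"
proof -
  obtain C where C: "1 \<le> C"
    and step: "\<And>\<rho> \<delta> \<P> \<P>'. 0 < \<rho> \<Longrightarrow> \<rho> \<le> 1 \<Longrightarrow> 0 < \<delta> \<Longrightarrow> \<delta> \<le> 1 \<Longrightarrow>
       tiling F (\<kappa> * \<delta>) \<delta> \<P> \<Longrightarrow> tiling F (\<kappa> * (\<rho> * \<delta>)) (\<rho> * \<delta>) \<P>' \<Longrightarrow>
       (\<And>B. B \<in> \<P>' \<Longrightarrow> \<exists>A\<in>\<P>. B \<subseteq> A) \<Longrightarrow>
       real (card (visible_pieces F \<P>')) \<le>
         C / \<rho> * (1 / (\<rho> * \<delta>) + real (card (visible_pieces F \<P>)))"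
    using card_visible_pieces_step by metis
  have "\<exists>\<P>. tiling F (\<kappa> * \<rho> ^ m) (\<rho> ^ m) \<P> \<and>
       real (card (visible_pieces F \<P>)) \<le> 1 / \<rho> * (2 * C / \<rho>) ^ m"
    if \<rho>: "0 < \<rho>" "\<rho> \<le> \<kappa>" for \<rho> m
  proof (induction m)
    case 0
    have "visible_pieces F {F} \<subseteq> {F}" by (auto simp: visible_pieces_def)
    then have "card (visible_pieces F {F}) \<le> 1"
      using card_mono[of "{F}" "visible_pieces F {F}"] by simp
    moreover have "1 \<le> 1 / \<rho>" using \<rho> \<kappa> by simp
    ultimately show ?case
      using tiling_self[of \<kappa> 1 F] \<kappa> by (intro exI[of _ "{F}"]) auto
  next
    case (Suc m)
    then obtain \<P> where \<P>: "tiling F (\<kappa> * \<rho> ^ m) (\<rho> ^ m) \<P>"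
      and IH: "real (card (visible_pieces F \<P>)) \<le> 1 / \<rho> * (2 * C / \<rho>) ^ m" by blast
    have \<rho>m: "0 < \<rho> ^ m" "\<rho> ^ m \<le> 1" using \<rho> \<kappa> by (auto intro: power_le_one)
    obtain \<P>' where \<P>': "tiling F (\<kappa> * (\<rho> * \<rho> ^ m)) (\<rho> * \<rho> ^ m) \<P>'"
      and refines: "\<And>B. B \<in> \<P>' \<Longrightarrow> \<exists>A\<in>\<P>. B \<subseteq> A"
      using tiling_refinement[OF \<P> \<rho> \<rho>m(1)] by metis
    have "1 / (\<rho> * \<rho> ^ m) = 1 / \<rho> * (1 / \<rho>) ^ m" by (simp add: power_one_over)
    also have "\<dots> \<le> 1 / \<rho> * (2 * C / \<rho>) ^ m"
      using \<rho> C by (intro mult_left_mono power_mono divide_right_mono) auto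
    finally have "1 / (\<rho> * \<rho> ^ m) + real (card (visible_pieces F \<P>)) \<le> 2 / \<rho> * (2 * C / \<rho>) ^ m"
      using IH by simp
    then have "C / \<rho> * (1 / (\<rho> * \<rho> ^ m) + real (card (visible_pieces F \<P>)))
        \<le> C / \<rho> * (2 / \<rho> * (2 * C / \<rho>) ^ m)"
      using C \<rho> by (intro mult_left_mono) auto
    moreover have "\<rho> \<le> 1" using \<rho> \<kappa> by simp
    ultimately have "real (card (visible_pieces F \<P>')) \<le> C / \<rho> * (2 / \<rho> * (2 * C / \<rho>) ^ m)"
      using step[OF \<rho>(1) _ \<rho>m \<P> \<P>' refines] by (meson order_trans)
    also have "\<dots> = 1 / \<rho> * (2 * C / \<rho>) ^ Suc m" by simp
    finally show ?case using \<P>' by auto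
  qed
  with C show ?thesis using that by blast
qed

text \<open>The growth factor \<open>2 C / \<rho>\<close> per step of ratio \<open>\<rho>\<close> corresponds to the exponent
  \<open>1 + ln (2 C) / ln (1 / \<rho>)\<close>, which is at most \<open>s\<close> once \<open>\<rho>\<close> is small.\<close>

proposition visible_covered_at_rate:
  assumes s: "1 < s"
  shows "covered_at_rate s (visible F)"
proof -
  obtain C where C: "1 \<le> C"
    and growth: "\<And>\<rho> m. 0 < \<rho> \<Longrightarrow> \<rho> \<le> \<kappa> \<Longrightarrow> \<exists>\<P>. tiling F (\<kappa> * \<rho> ^ m) (\<rho> ^ m) \<P> \<and>
       real (card (visible_pieces F \<P>)) \<le> 1 / \<rho> * (2 * C / \<rho>) ^ m"
    using card_visible_pieces_growth by metis
  \<comment> \<open>The second bound ensures \<open>2 C \<rho>\<^sup>s\<^sup>-\<^sup>1 \<le> 1\<close>; halving \<open>\<kappa>\<close> keeps \<open>\<rho>\<close> below 1.\<close>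
  define \<rho> where "\<rho> = min (\<kappa> / 2) ((1 / (2 * C)) powr (1 / (s - 1)))"
  have \<rho>: "0 < \<rho>" "\<rho> \<le> \<kappa>" "\<rho> < 1" using \<kappa> C by (auto simp: \<rho>_def)
  have "\<rho> powr (s - 1) \<le> ((1 / (2 * C)) powr (1 / (s - 1))) powr (s - 1)"
    using \<rho> s by (intro powr_mono2) (auto simp: \<rho>_def)
  also have "\<dots> = 1 / (2 * C)" using s C by (simp add: powr_powr)
  finally have "2 * C * \<rho> powr (s - 1) \<le> 1" using C by (simp add: field_simps)
  then have "2 * C / \<rho> \<le> 1 / (\<rho> powr (s - 1) * \<rho>)"
    using \<rho> by (simp add: field_simps)
  also have "\<dots> = \<rho> powr - s"
    using \<rho> powr_add[of \<rho> "s - 1" 1] by (simp add: powr_minus_divide)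
  finally have rate: "2 * C / \<rho> \<le> \<rho> powr - s" .
  obtain D where D: "1 \<le> D" "\<And>x y. x \<in> F \<Longrightarrow> y \<in> F \<Longrightarrow> dist x y \<le> D"
    using compact_imp_bounded[OF compact]
    by (metis bounded_two_points linear order_trans)
  define K where "K = 1 / \<rho> * (\<rho> powr - s * D powr s)"
  have "\<exists>\<U>. finite \<U> \<and> visible F \<subseteq> \<Union>\<U> \<and> (\<forall>U\<in>\<U>. bounded U \<and> diameter U \<le> \<delta>) \<and>
             real (card \<U>) \<le> K * \<delta> powr - s" if \<delta>: "0 < \<delta>" "\<delta> \<le> 1" for \<delta>
  proof -
    \<comment> \<open>The first level at which the diameters are certainly below \<open>\<delta>\<close>; the level before it is still coarse,
      which bounds \<open>\<rho>\<^sup>n\<close> from below by \<open>\<rho> \<delta> / D\<close>.\<close>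
    have "\<exists>n. \<rho> ^ n < \<delta> / D" using real_arch_pow_inv \<delta> D \<rho> by auto
    define n where "n = (LEAST n. \<rho> ^ n < \<delta> / D)"
    have n: "\<rho> ^ n < \<delta> / D" unfolding n_def by (rule LeastI_ex) fact
    have "\<delta> / D \<le> 1" using \<delta> D(1) by simp
    then have "n \<noteq> 0" using n by (cases "n = 0") auto
    then obtain m where m: "n = Suc m" by (cases n) auto
    have "\<not> \<rho> ^ m < \<delta> / D" using not_less_Least[of m "\<lambda>n. \<rho> ^ n < \<delta> / D"] m by (simp add: n_def)
    then have m2: "\<delta> / D \<le> \<rho> ^ m" by simp
    obtain \<P> where \<P>: "tiling F (\<kappa> * \<rho> ^ n) (\<rho> ^ n) \<P>"
      and card: "real (card (visible_pieces F \<P>)) \<le> 1 / \<rho> * (2 * C / \<rho>) ^ n"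
      using growth[OF \<rho>(1,2)] by blast
    have diam: "bounded A \<and> diameter A \<le> \<delta>" if A: "A \<in> visible_pieces F \<P>" for A
    proof -
      have AP: "A \<in> \<P>" using A by (simp add: visible_pieces_def)
      have "D * \<rho> ^ n \<le> \<delta>" using n D by (simp add: field_simps)
      then have le: "dist x y \<le> \<delta>" if "x \<in> A" "y \<in> A" for x y
        using tiling_piece_diam[OF \<P> AP that D(2)] by simp
      have "A \<subseteq> F" using tilingD(2)[OF \<P>] AP by blast
      then have "bounded A" using compact_imp_bounded[OF compact] bounded_subset by blast
      moreover have "diameter A \<le> \<delta>"
        using le \<delta> by (intro diameter_le) (auto simp: dist_norm)
      ultimately show ?thesis by simp
    qed
    have "(2 * C / \<rho>) ^ n \<le> (\<rho> powr - s) ^ n"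
      using rate C \<rho> by (intro power_mono) auto
    also have "\<dots> = \<rho> powr - s * (\<rho> ^ m) powr - s"
      using \<rho> m by (simp add: powr_power powr_realpow[symmetric] powr_powr powr_add[symmetric] algebra_simps)
    also have "(\<rho> ^ m) powr - s \<le> (\<delta> / D) powr - s"
      using m2 \<delta> D s by (intro powr_mono2') auto
    also have "(\<delta> / D) powr - s = D powr s * \<delta> powr - s"
      using \<delta> D by (simp add: powr_divide powr_minus_divide)
    finally have "1 / \<rho> * (2 * C / \<rho>) ^ n \<le> 1 / \<rho> * (\<rho> powr - s * (D powr s * \<delta> powr - s))"
      using \<rho> by (intro mult_left_mono) (auto simp: mult_left_mono)
    then have "real (card (visible_pieces F \<P>)) \<le> K * \<delta> powr - s"
      using card by (simp add: K_def mult.assoc)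
    moreover have "visible F \<subseteq> \<Union>(visible_pieces F \<P>)"
    proof
      fix x assume x: "x \<in> visible F"
      then have "x \<in> \<Union>\<P>" using tilingD(2)[OF \<P>] by (simp add: visible_def)
      then show "x \<in> \<Union>(visible_pieces F \<P>)" using x by (auto simp: visible_pieces_def)
    qed
    moreover have "finite (visible_pieces F \<P>)"
      using tilingD(1)[OF \<P>] by (simp add: visible_pieces_def)
    ultimately show ?thesis using diam by blast
  qed
  moreover have "0 < K" using \<rho> D by (simp add: K_def)
  ultimately show ?thesis unfolding covered_at_rate_def by blast
qed

text \<open>The projection of \<open>F\<close> is convex, hence equal to that of the hull, and the hull contains a disc.\<close>

lemma projection_contains_interval:
  obtains a b where "a < b" "{a..b} \<subseteq> (\<lambda>x. x \<bullet> e) ` visible F"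
proof -
  obtain c \<epsilon> where \<epsilon>: "0 < \<epsilon>" "cball c \<epsilon> \<subseteq> convex hull F"
    using hull_interior_ne unfolding hull_interior_def ex_in_conv[symmetric] mem_interior_cball
    by blast
  let ?\<pi> = "(\<lambda>x. x \<bullet> e) ` F"
  have "similarity 1 (\<lambda>x::'a. x)" by (simp add: similarity_def)
  from proj_convex[OF this] have conv: "convex ?\<pi>" by simp
  have lin: "linear (\<lambda>x. x \<bullet> e)" by (intro bounded_linear.linear bounded_linear_inner_left)
  have hull: "(\<lambda>x. x \<bullet> e) ` (convex hull F) = ?\<pi>"
    using convex_hull_linear_image[OF lin, of F] conv by (simp add: hull_same)
  have "c \<in> convex hull F" "c + \<epsilon> *\<^sub>R e \<in> convex hull F"
    using \<epsilon> norm_e by (auto simp: dist_norm intro!: subsetD[OF \<epsilon>(2)])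
  then have ends: "c \<bullet> e \<in> ?\<pi>" "(c + \<epsilon> *\<^sub>R e) \<bullet> e \<in> ?\<pi>"
    using hull by blast+
  have "e \<bullet> e = 1" using norm_e by (simp add: norm_eq_1)
  then have "c \<bullet> e < (c + \<epsilon> *\<^sub>R e) \<bullet> e" using \<epsilon> by (simp add: inner_add_left)
  moreover have "{c \<bullet> e..(c + \<epsilon> *\<^sub>R e) \<bullet> e} \<subseteq> ?\<pi>"
  proof
    fix t assume "t \<in> {c \<bullet> e..(c + \<epsilon> *\<^sub>R e) \<bullet> e}"
    then show "t \<in> ?\<pi>"
      using mem_is_interval_1_I[OF _ ends] conv by (simp add: is_interval_convex_1)
  qed
  ultimately show ?thesis using that projection_visible[OF compact] by metis
qed

end

section \<open>The plane\<close>

definition quarter_turn :: "real^2 \<Rightarrow> real^2" where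
  "quarter_turn \<theta> = vector [- \<theta> $ 2, \<theta> $ 1]"

lemma plane_frame_quarter_turn:
  assumes "norm \<theta> = 1"
  shows "plane_frame (quarter_turn \<theta>) \<theta>"
proof
  have 1: "(\<theta> $ 1)\<^sup>2 + (\<theta> $ 2)\<^sup>2 = 1"
    using assms by (simp add: norm_eq_1 inner_vec_def UNIV_2 power2_eq_square)
  show "norm (quarter_turn \<theta>) = 1"
    using 1 by (simp add: norm_eq_1 inner_vec_def UNIV_2 power2_eq_square quarter_turn_def)
  show "\<theta> \<bullet> quarter_turn \<theta> = 0"
    by (simp add: inner_vec_def UNIV_2 quarter_turn_def)
  show "(norm x)\<^sup>2 = (x \<bullet> quarter_turn \<theta>)\<^sup>2 + (x \<bullet> \<theta>)\<^sup>2" for x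
  proof -
    have "(x \<bullet> quarter_turn \<theta>)\<^sup>2 + (x \<bullet> \<theta>)\<^sup>2 =
        ((x $ 1)\<^sup>2 + (x $ 2)\<^sup>2) * ((\<theta> $ 1)\<^sup>2 + (\<theta> $ 2)\<^sup>2)"
      by (simp add: inner_vec_def UNIV_2 quarter_turn_def) algebra
    also have "\<dots> = x \<bullet> x"
      unfolding 1 by (simp add: inner_vec_def UNIV_2 power2_eq_square)
    also have "\<dots> = (norm x)\<^sup>2" by (rule power2_norm_eq_inner[symmetric])
    finally show ?thesis by simp
  qed
qed (fact assms)

lemma visible_part_eq_visible:
  assumes "norm \<theta> = 1"
  shows "visible_part \<theta> F = plane_frame.visible (quarter_turn \<theta>) \<theta> F"
proof -
  interpret plane_frame "quarter_turn \<theta>" \<theta> by (rule plane_frame_quarter_turn[OF assms])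
  have \<theta>: "\<theta> \<bullet> \<theta> = 1" using assms by (simp add: norm_eq_1)
  have ray: "y \<in> (\<lambda>y. x + y) ` half_line \<theta> \<longleftrightarrow>
      y \<bullet> quarter_turn \<theta> = x \<bullet> quarter_turn \<theta> \<and> x \<bullet> \<theta> \<le> y \<bullet> \<theta>" for x y
  proof
    assume "y \<in> (\<lambda>y. x + y) ` half_line \<theta>"
    then show "y \<bullet> quarter_turn \<theta> = x \<bullet> quarter_turn \<theta> \<and> x \<bullet> \<theta> \<le> y \<bullet> \<theta>"
      using \<theta> orth by (auto simp: half_line_def inner_add_left)
  next
    assume y: "y \<bullet> quarter_turn \<theta> = x \<bullet> quarter_turn \<theta> \<and> x \<bullet> \<theta> \<le> y \<bullet> \<theta>"
    have "y = x + (y \<bullet> \<theta> - x \<bullet> \<theta>) *\<^sub>R \<theta>"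
      by (rule eqI) (use y \<theta> orth in \<open>simp_all add: inner_add_left\<close>)
    then show "y \<in> (\<lambda>y. x + y) ` half_line \<theta>"
      using y unfolding half_line_def by (intro image_eqI[of _ _ "(y \<bullet> \<theta> - x \<bullet> \<theta>) *\<^sub>R \<theta>"]) auto
  qed
  have "((\<lambda>y. x + y) ` half_line \<theta> \<inter> F = {x}) \<longleftrightarrow>
      (\<forall>y\<in>F. y \<bullet> quarter_turn \<theta> = x \<bullet> quarter_turn \<theta> \<longrightarrow> y \<bullet> \<theta> \<le> x \<bullet> \<theta>)" if x: "x \<in> F" for x
  proof
    assume *: "(\<lambda>y. x + y) ` half_line \<theta> \<inter> F = {x}"
    show "\<forall>y\<in>F. y \<bullet> quarter_turn \<theta> = x \<bullet> quarter_turn \<theta> \<longrightarrow> y \<bullet> \<theta> \<le> x \<bullet> \<theta>"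
    proof (intro ballI impI, rule ccontr)
      fix y assume y: "y \<in> F" "y \<bullet> quarter_turn \<theta> = x \<bullet> quarter_turn \<theta>" "\<not> y \<bullet> \<theta> \<le> x \<bullet> \<theta>"
      then have "y \<in> (\<lambda>y. x + y) ` half_line \<theta> \<inter> F" using ray[of y x] by simp
      with * y(3) show False by auto
    qed
  next
    assume *: "\<forall>y\<in>F. y \<bullet> quarter_turn \<theta> = x \<bullet> quarter_turn \<theta> \<longrightarrow> y \<bullet> \<theta> \<le> x \<bullet> \<theta>"
    show "(\<lambda>y. x + y) ` half_line \<theta> \<inter> F = {x}"
    proof (intro set_eqI iffI)
      fix y assume "y \<in> (\<lambda>y. x + y) ` half_line \<theta> \<inter> F"
      then show "y \<in> {x}" using ray[of y x] * eqI[of y x] by auto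
    next
      fix y assume "y \<in> {x}"
      then show "y \<in> (\<lambda>y. x + y) ` half_line \<theta> \<inter> F" using ray[of x x] x by simp
    qed
  qed
  then show ?thesis unfolding visible_part_def visible_def by blast
qed

lemma convex_coordinate_image:
  assumes \<theta>: "norm \<theta> = 1" and J: "interval_in_line (perp_line \<theta>) (proj \<theta> ` F)"
    and e: "e \<bullet> \<theta> = 0"
  shows "convex ((\<lambda>x. x \<bullet> e) ` F)"
proof -
  obtain a v T where T: "is_interval T" "proj \<theta> ` F = (\<lambda>t::real. a + t *\<^sub>R v) ` T"
    using J unfolding interval_in_line_def by blast
  have conv: "convex (proj \<theta> ` F)"
  proof -
    have "convex ((\<lambda>t. t *\<^sub>R v) ` T)"
      by (rule convex_linear_image) (use T in \<open>auto simp: is_interval_convex_1 linear_scale_left\<close>)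
    then have "convex ((\<lambda>x. a + x) ` (\<lambda>t. t *\<^sub>R v) ` T)" by (rule convex_translation)
    then show ?thesis unfolding T(2) by (simp add: image_image)
  qed
  have "convex ((\<lambda>x. x \<bullet> e) ` proj \<theta> ` F)"
    by (rule convex_linear_image[OF bounded_linear.linear[OF bounded_linear_inner_left] conv])
  moreover have "proj \<theta> x \<bullet> e = x \<bullet> e" for x
    using e by (simp add: proj_def inner_diff_left inner_commute[of \<theta> e])
  ultimately show ?thesis by (simp add: image_image)
qed

text \<open>If \<open>f\<close> has the orthogonal part \<open>T\<close>, then \<open>f x \<bullet> e\<close> is an affine function of \<open>x \<bullet> T\<^sup>-\<^sup>1 e\<close>, and this is a
  coordinate of the projection of \<open>F\<close> along the direction perpendicular to \<open>T\<^sup>-\<^sup>1 e\<close>.\<close>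

lemma convex_coordinate_image_similarity:
  fixes F :: "(real^2) set"
  assumes J: "\<forall>\<theta>. norm \<theta> = 1 \<longrightarrow> interval_in_line (perp_line \<theta>) (proj \<theta> ` F)"
    and f: "similarity r f" and e: "norm e = 1"
  shows "convex ((\<lambda>x. x \<bullet> e) ` f ` F)"
proof -
  obtain T where T: "orthogonal_transformation T" "f = (\<lambda>x. f 0 + r *\<^sub>R T x)"
    using similarity_affine[OF f] .
  obtain e' where e': "T e' = e" using orthogonal_transformation_surj[OF T(1)] by (metis surjD)
  have ne': "norm e' = 1"
    using e e' T(1) by (metis orthogonal_transformation_norm)
  have "norm (quarter_turn e') = 1" "e' \<bullet> quarter_turn e' = 0"
    using plane_frame_quarter_turn[OF ne'] by (auto simp: plane_frame_def)
  then have conv: "convex ((\<lambda>x. x \<bullet> e') ` F)"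
    using J by (intro convex_coordinate_image[of "quarter_turn e'"]) auto
  have eq: "f x \<bullet> e = f 0 \<bullet> e + r *\<^sub>R (x \<bullet> e')" for x
  proof -
    have "T x \<bullet> e = x \<bullet> e'"
      using T(1) e' unfolding orthogonal_transformation_def by metis
    then show ?thesis by (subst T(2)) (simp add: inner_add_left)
  qed
  have "(\<lambda>x. x \<bullet> e) ` f ` F = (\<lambda>t. f 0 \<bullet> e + r *\<^sub>R t) ` (\<lambda>x. x \<bullet> e') ` F"
    unfolding image_image by (rule image_cong[OF refl eq])
  then show ?thesis using convex_affinity[OF conv] by metis
qed

lemma hull_interior_ne_if_not_collinear:
  fixes F :: "(real^2) set"
  assumes "\<not> collinear F"
  shows "hull_interior F \<noteq> {}"
proof
  assume "hull_interior F = {}"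
  then obtain a b where a: "a \<noteq> 0" "convex hull F \<subseteq> {x. a \<bullet> x = b}"
    using empty_interior_subset_hyperplane[of "convex hull F"] by (auto simp: hull_interior_def)
  define \<theta> where "\<theta> = a /\<^sub>R norm a"
  have \<theta>: "norm \<theta> = 1" using a(1) by (simp add: \<theta>_def)
  interpret plane_frame "quarter_turn \<theta>" \<theta> by (rule plane_frame_quarter_turn[OF \<theta>])
  have "\<exists>c. x - y = c *\<^sub>R quarter_turn \<theta>" if "x \<in> F" "y \<in> F" for x y
  proof -
    have "a \<bullet> x = b" "a \<bullet> y = b" using a(2) that hull_subset[of F convex] by auto
    then have "(x - y) \<bullet> \<theta> = 0" by (simp add: \<theta>_def inner_diff_right inner_commute)
    moreover have "quarter_turn \<theta> \<bullet> quarter_turn \<theta> = 1" "quarter_turn \<theta> \<bullet> \<theta> = 0"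
      using norm_e orth by (simp_all add: norm_eq_1 inner_commute)
    ultimately have "x - y = ((x - y) \<bullet> quarter_turn \<theta>) *\<^sub>R quarter_turn \<theta>"
      by (intro eqI) simp_all
    then show ?thesis by blast
  qed
  then have "collinear F" unfolding collinear_def by blast
  with assms show False ..
qed

theorem theorem2p1:
  fixes N :: nat and S :: "nat \<Rightarrow> real^2 \<Rightarrow> real^2" and F :: "(real^2) set"
  assumes "\<forall>i\<in>{1..N}. contracting_similarity (S i)"
    and "convex_open_set_condition N S"
    and "is_attractor N S F"
    and "\<not> collinear F"
    and "\<forall>\<theta>. norm \<theta> = 1 \<longrightarrow> interval_in_line (perp_line \<theta>) (proj \<theta> ` F)"
  shows "\<forall>\<theta>. norm \<theta> = 1 \<longrightarrow>
           hausdorff_dim (visible_part \<theta> F) = 1 \<and>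
           lower_box_dim (visible_part \<theta> F) = 1 \<and>
           upper_box_dim (visible_part \<theta> F) = 1"
proof (intro allI impI)
  fix \<theta> :: "real^2" assume \<theta>: "norm \<theta> = 1"
  obtain \<kappa> where \<kappa>: "0 < \<kappa>" "\<kappa> \<le> 1"
    and tilings: "\<And>\<delta>. 0 < \<delta> \<Longrightarrow> \<delta> \<le> 1 \<Longrightarrow> \<exists>\<P>. tiling F (\<kappa> * \<delta>) \<delta> \<P>"
    using tilings_at_all_scales[OF assms(1,3,2)] by metis
  interpret plane_frame "quarter_turn \<theta>" \<theta> by (rule plane_frame_quarter_turn[OF \<theta>])
  interpret self_similar_frame "quarter_turn \<theta>" \<theta> F \<kappa>
  proof
    show "compact F" using assms(3) unfolding is_attractor_def by blast
    show "hull_interior F \<noteq> {}" by (rule hull_interior_ne_if_not_collinear[OF assms(4)])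
    show "convex ((\<lambda>x. x \<bullet> quarter_turn \<theta>) ` f ` F)" if "similarity r f" for r f
      by (rule convex_coordinate_image_similarity[OF assms(5) that norm_e])
  qed (use \<kappa> tilings in auto)
  obtain a b where ab: "a < b" "{a..b} \<subseteq> (\<lambda>x. x \<bullet> quarter_turn \<theta>) ` visible F"
    using projection_contains_interval .
  show "hausdorff_dim (visible_part \<theta> F) = 1 \<and> lower_box_dim (visible_part \<theta> F) = 1 \<and>
      upper_box_dim (visible_part \<theta> F) = 1"
    unfolding visible_part_eq_visible[OF \<theta>]
    using dimensions_eq_1[OF visible_covered_at_rate norm_e ab] by blast
qed

end
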